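(* Let $\mathcal{C}$ be a cartesian closed category. Then directed colimits commute with finite products in $\mathcal{C}$. That is, let $\mathcal{D}$ be a directed poset (viewed as a category), let $n\in\mathbb{N}$, let $D_1,\dots,D_n:\mathcal{D}\to\mathcal{C}$ be diagrams, and suppose that for each $j=1,\dots,n$ a colimit cocone $(c^j_d: D_jd\to C_j)_{d\in\mathcal{D}}$ of $D_j$ exists in $\mathcal{C}$. Then the cocone $(c^1_d\times\cdots\times c^n_d: D_1d\times\cdots\times D_nd\to C_1\times\cdots\times C_n)_{d\in\mathcal{D}}$ is a colimit cocone of the diagram $D_1\times\cdots\times D_n:\mathcal{D}\to\mathcal{C}$, $d\mapsto D_1d\times\cdots\times D_nd$.
   Context: A category is cartesian closed if it has finite products and, for every object $Y$, the functor $-\times Y$ has a right adjoint. A directed poset is a nonempty poset in which every two elements have an upper bound. *)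

theory Defs
  imports Main
begin

section \<open>Categories and functors\<close>

record ('o, 'm) category =
  Obj :: "'o set"
  Arr :: "'m set"
  Dom :: "'m \<Rightarrow> 'o"
  Cod :: "'m \<Rightarrow> 'o"
  Idn :: "'o \<Rightarrow> 'm"
  Cmp :: "'m \<Rightarrow> 'm \<Rightarrow> 'm"  \<comment> \<open>\<open>Cmp C g f\<close> is \<open>g\<close> after \<open>f\<close>, meaningful if \<open>Cod C f = Dom C g\<close>\<close>

definition hom_set :: "('o, 'm) category \<Rightarrow> 'o \<Rightarrow> 'o \<Rightarrow> 'm set" where
  "hom_set C X Y = {f \<in> Arr C. Dom C f = X \<and> Cod C f = Y}"

locale category =
  fixes C :: "('o, 'm) category"
  assumes dom_in_obj: "f \<in> Arr C \<Longrightarrow> Dom C f \<in> Obj C"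
    and cod_in_obj: "f \<in> Arr C \<Longrightarrow> Cod C f \<in> Obj C"
    and id_in_hom: "X \<in> Obj C \<Longrightarrow> Idn C X \<in> hom_set C X X"
    and comp_in_hom: "f \<in> hom_set C X Y \<Longrightarrow> g \<in> hom_set C Y Z \<Longrightarrow> Cmp C g f \<in> hom_set C X Z"
    and comp_id: "f \<in> hom_set C X Y \<Longrightarrow> Cmp C f (Idn C X) = f"
    and id_comp: "f \<in> hom_set C X Y \<Longrightarrow> Cmp C (Idn C Y) f = f"
    and comp_assoc: "f \<in> hom_set C W X \<Longrightarrow> g \<in> hom_set C X Y \<Longrightarrow> h \<in> hom_set C Y Z \<Longrightarrow>
      Cmp C h (Cmp C g f) = Cmp C (Cmp C h g) f"

record ('o, 'm, 'p, 'n) cat_functor =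
  FObj :: "'o \<Rightarrow> 'p"
  FArr :: "'m \<Rightarrow> 'n"

locale cat_functor = A: category A + B: category B
  for A :: "('o, 'm) category" and B :: "('p, 'n) category" +
  fixes F :: "('o, 'm, 'p, 'n) cat_functor"
  assumes obj_map: "X \<in> Obj A \<Longrightarrow> FObj F X \<in> Obj B"
    and arr_map: "f \<in> hom_set A X Y \<Longrightarrow> FArr F f \<in> hom_set B (FObj F X) (FObj F Y)"
    and preserves_id: "X \<in> Obj A \<Longrightarrow> FArr F (Idn A X) = Idn B (FObj F X)"
    and preserves_comp: "f \<in> hom_set A X Y \<Longrightarrow> g \<in> hom_set A Y Z \<Longrightarrow>
      FArr F (Cmp A g f) = Cmp B (FArr F g) (FArr F f)"

definition id_functor :: "('o, 'm, 'o, 'm) cat_functor" where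
  "id_functor = \<lparr>FObj = (\<lambda>X. X), FArr = (\<lambda>f. f)\<rparr>"

definition const_functor :: "('p, 'n) category \<Rightarrow> 'p \<Rightarrow> ('o, 'm, 'p, 'n) cat_functor" where
  "const_functor B Y = \<lparr>FObj = (\<lambda>_. Y), FArr = (\<lambda>_. Idn B Y)\<rparr>"

text \<open>
  \<open>F\<close> has a right adjoint: there are a functor \<open>G\<close> in the opposite direction and bijections
  \<open>\<phi> X Y : Hom(F X, Y) \<cong> Hom(X, G Y)\<close> that are natural in both variables.
\<close>

definition has_right_adjoint ::
  "('o, 'm) category \<Rightarrow> ('p, 'n) category \<Rightarrow> ('o, 'm, 'p, 'n) cat_functor \<Rightarrow> bool" where
  "has_right_adjoint A B F \<longleftrightarrow> cat_functor A B F \<and>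
    (\<exists>(G :: ('p, 'n, 'o, 'm) cat_functor) (\<phi> :: 'o \<Rightarrow> 'p \<Rightarrow> 'n \<Rightarrow> 'm). cat_functor B A G \<and>
      (\<forall>X \<in> Obj A. \<forall>Y \<in> Obj B.
        bij_betw (\<phi> X Y) (hom_set B (FObj F X) Y) (hom_set A X (FObj G Y))) \<and>
      (\<forall>X' \<in> Obj A. \<forall>X \<in> Obj A. \<forall>Y \<in> Obj B. \<forall>Y' \<in> Obj B.
        \<forall>a \<in> hom_set A X' X. \<forall>b \<in> hom_set B Y Y'. \<forall>h \<in> hom_set B (FObj F X) Y.
          \<phi> X' Y' (Cmp B b (Cmp B h (FArr F a))) = Cmp A (FArr G b) (Cmp A (\<phi> X Y h) a)))"


section \<open>Products\<close>

text \<open>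
  Products are given by product cones \<open>(P, p)\<close> with vertex \<open>P\<close> and projections \<open>p j\<close>,
  rather than by a globally fixed choice.
\<close>

definition is_product ::
  "('o, 'm) category \<Rightarrow> 'i set \<Rightarrow> ('i \<Rightarrow> 'o) \<Rightarrow> 'o \<Rightarrow> ('i \<Rightarrow> 'm) \<Rightarrow> bool" where
  "is_product C I A P p \<longleftrightarrow> P \<in> Obj C \<and> (\<forall>j \<in> I. p j \<in> hom_set C P (A j)) \<and>
    (\<forall>X \<in> Obj C. \<forall>f. (\<forall>j \<in> I. f j \<in> hom_set C X (A j)) \<longrightarrow>
      (\<exists>!m. m \<in> hom_set C X P \<and> (\<forall>j \<in> I. Cmp C (p j) m = f j)))"

text \<open>The case \<open>n = 0\<close> below provides a terminal object.\<close>

definition has_finite_products :: "('o, 'm) category \<Rightarrow> bool" where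
  "has_finite_products C \<longleftrightarrow>
    (\<forall>(n :: nat) A. (\<forall>j \<in> {1..n}. A j \<in> Obj C) \<longrightarrow> (\<exists>P p. is_product C {1..n} A P p))"

text \<open>
  The arrow \<open>\<Prod>\<^sub>j f j : P \<rightarrow> Q\<close> induced by arrows \<open>f j : A j \<rightarrow> B j\<close>, where \<open>(P, p)\<close> and
  \<open>(Q, q)\<close> are products of the families \<open>A\<close> and \<open>B\<close>.
\<close>

definition prod_arr ::
  "('o, 'm) category \<Rightarrow> 'i set \<Rightarrow> 'o \<Rightarrow> ('i \<Rightarrow> 'm) \<Rightarrow> 'o \<Rightarrow> ('i \<Rightarrow> 'm) \<Rightarrow> ('i \<Rightarrow> 'm) \<Rightarrow> 'm" where
  "prod_arr C I P p Q q f =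
    (THE m. m \<in> hom_set C P Q \<and> (\<forall>j \<in> I. Cmp C (q j) m = Cmp C (f j) (p j)))"

text \<open>
  The pointwise product \<open>X \<mapsto> \<Prod>\<^sub>j F j X\<close> of functors \<open>F j : J \<rightarrow> C\<close>, where \<open>(P X, p X)\<close> is a
  product of the objects \<open>F j X\<close>.
\<close>

definition prod_functor ::
  "('s, 't) category \<Rightarrow> ('o, 'm) category \<Rightarrow> 'i set \<Rightarrow> ('i \<Rightarrow> ('s, 't, 'o, 'm) cat_functor) \<Rightarrow>
    ('s \<Rightarrow> 'o) \<Rightarrow> ('s \<Rightarrow> 'i \<Rightarrow> 'm) \<Rightarrow> ('s, 't, 'o, 'm) cat_functor" where
  "prod_functor J C I F P p =
    \<lparr>FObj = P,
     FArr = (\<lambda>a. prod_arr C I (P (Dom J a)) (p (Dom J a)) (P (Cod J a)) (p (Cod J a))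
       (\<lambda>j. FArr (F j) a))\<rparr>"

text \<open>
  The functor \<open>- \<times> Y\<close> is the product of the identity functor and the functor constant at \<open>Y\<close>.
  It depends on a choice of binary products \<open>(P X, p X)\<close> of \<open>X\<close> and \<open>Y\<close>, but only up to natural
  isomorphism, so having a right adjoint does not depend on that choice.
\<close>

definition times_family :: "('o, 'm) category \<Rightarrow> 'o \<Rightarrow> nat \<Rightarrow> ('o, 'm, 'o, 'm) cat_functor" where
  "times_family C Y j = (if j = 1 then id_functor else const_functor C Y)"

definition cartesian_closed :: "('o, 'm) category \<Rightarrow> bool" where
  "cartesian_closed C \<longleftrightarrow> has_finite_products C \<and>
    (\<forall>Y \<in> Obj C. \<exists>P p.
      (\<forall>X \<in> Obj C. is_product C {1..2} (\<lambda>j. FObj (times_family C Y j) X) (P X) (p X)) \<and>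
      has_right_adjoint C C (prod_functor C C {1..2} (times_family C Y) P p))"


section \<open>Colimits over directed posets\<close>

definition is_cocone ::
  "('s, 't) category \<Rightarrow> ('o, 'm) category \<Rightarrow> ('s, 't, 'o, 'm) cat_functor \<Rightarrow>
    'o \<Rightarrow> ('s \<Rightarrow> 'm) \<Rightarrow> bool" where
  "is_cocone J C F L c \<longleftrightarrow> cat_functor J C F \<and> L \<in> Obj C \<and>
    (\<forall>d \<in> Obj J. c d \<in> hom_set C (FObj F d) L) \<and>
    (\<forall>a \<in> Arr J. Cmp C (c (Cod J a)) (FArr F a) = c (Dom J a))"

definition is_colimit_cocone ::
  "('s, 't) category \<Rightarrow> ('o, 'm) category \<Rightarrow> ('s, 't, 'o, 'm) cat_functor \<Rightarrow>
    'o \<Rightarrow> ('s \<Rightarrow> 'm) \<Rightarrow> bool" where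
  "is_colimit_cocone J C F L c \<longleftrightarrow> is_cocone J C F L c \<and>
    (\<forall>L' c'. is_cocone J C F L' c' \<longrightarrow>
      (\<exists>!u. u \<in> hom_set C L L' \<and> (\<forall>d \<in> Obj J. Cmp C u (c d) = c' d)))"

definition directed_poset :: "'d set \<Rightarrow> 'd rel \<Rightarrow> bool" where
  "directed_poset D r \<longleftrightarrow> partial_order_on D r \<and> D \<noteq> {} \<and>
    (\<forall>x \<in> D. \<forall>y \<in> D. \<exists>z \<in> D. (x, z) \<in> r \<and> (y, z) \<in> r)"

definition poset_category :: "'d set \<Rightarrow> 'd rel \<Rightarrow> ('d, 'd \<times> 'd) category" where
  "poset_category D r =
    \<lparr>Obj = D, Arr = r, Dom = fst, Cod = snd,
     Idn = (\<lambda>x. (x, x)), Cmp = (\<lambda>g f. (fst f, snd g))\<rparr>"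

lemma category_poset_category:
  assumes "partial_order_on D r"
  shows "category (poset_category D r)"
  using assms
  by unfold_locales
    (auto simp: poset_category_def hom_set_def partial_order_on_def preorder_on_def refl_on_def
      dest: transD)

end

theory Submission
  imports Defs
begin

text \<open>
  As a left adjoint, \<open>- \<times> Y\<close> preserves colimits. For two factors, directedness turns cocones on
  \<open>d \<mapsto> E d \<times> F d\<close> into families on \<open>(d, d') \<mapsto> E d \<times> F d'\<close> compatible in each variable, so the
  colimit can be taken in \<open>d'\<close> and then in \<open>d\<close>. The general case follows by induction on the
  number of factors; that of the empty product says that a constant diagram of terminal objects
  over a directed poset has a terminal colimit.
\<close>

section \<open>Binary products\<close>

text \<open>The diagonal of a directed poset is cofinal in its square, which is why a colimit over
  pairs \<open>(d, d')\<close> can be read off along \<open>d = d'\<close>. Cartesian closure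
  contributes the rest: multiplication by each fixed \<open>FObj E d\<close> preserves the colimit
  \<open>M\<close> of \<open>F\<close>, and multiplication by \<open>M\<close> preserves the colimit
  \<open>L\<close> of \<open>E\<close>. What shapes the proof is that products are not chosen
  globally. The cones in the theorem are arbitrary, the adjunction speaks of its own choice of
  products, and the mixed products of \<open>FObj E d\<close> with \<open>FObj F d'\<close> or with
  \<open>M\<close> come with no cone at all. Product cones are therefore carried along as data, and
  two cones over the same factors are compared by the arrow id \<times> id between their vertices.
  The induction starts at zero factors, so a single factor is already an instance of the step, with
  a diagram of terminal objects as first factor. The base case is where nonemptiness of the poset
  matters: over the empty poset the colimit would be initial.\<close>

text \<open>
  A binary product cone is a triple of the vertex and its two projections; \<open>bmap C K K' x y\<close> is
  the arrow \<open>x \<times> y\<close> between the vertices of \<open>K\<close> and \<open>K'\<close>.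
\<close>

definition is_binprod :: "('o, 'm) category \<Rightarrow> 'o \<Rightarrow> 'o \<Rightarrow> 'o \<times> 'm \<times> 'm \<Rightarrow> bool" where
  "is_binprod C X Y = (\<lambda>(P, a, b). a \<in> hom_set C P X \<and> b \<in> hom_set C P Y \<and>
    (\<forall>W f g. f \<in> hom_set C W X \<longrightarrow> g \<in> hom_set C W Y \<longrightarrow>
      (\<exists>!m. m \<in> hom_set C W P \<and> Cmp C a m = f \<and> Cmp C b m = g)))"

definition bmap ::
  "('o, 'm) category \<Rightarrow> 'o \<times> 'm \<times> 'm \<Rightarrow> 'o \<times> 'm \<times> 'm \<Rightarrow> 'm \<Rightarrow> 'm \<Rightarrow> 'm" where
  "bmap C = (\<lambda>(P, a, b) (P', a', b') x y.
    THE m. m \<in> hom_set C P P' \<and> Cmp C a' m = Cmp C x a \<and> Cmp C b' m = Cmp C y b)"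

text \<open>The adjunction is given for multiplication on the right. Exchanging the projections
  while keeping the vertex makes it usable for multiplication on the left as well.\<close>

definition swap_cone :: "'o \<times> 'm \<times> 'm \<Rightarrow> 'o \<times> 'm \<times> 'm" where
  "swap_cone = (\<lambda>(P, a, b). (P, b, a))"

lemma fst_swap_cone [simp]: "fst (swap_cone K) = fst K"
  by (simp add: swap_cone_def split: prod.split)

lemma is_binprod_swap: "is_binprod C X Y K \<Longrightarrow> is_binprod C Y X (swap_cone K)"
  unfolding is_binprod_def swap_cone_def by (simp add: conj_commute split: prod.splits)

lemma bmap_swap: "bmap C (swap_cone K) (swap_cone K') y x = bmap C K K' x y"
  unfolding bmap_def swap_cone_def by (simp add: conj_commute split: prod.split)

context category
begin

section \<open>Functoriality of binary products in both arguments\<close>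

lemma hom_Obj:
  assumes "f \<in> hom_set C X Y"
  shows "X \<in> Obj C" and "Y \<in> Obj C"
  using assms dom_in_obj cod_in_obj by (auto simp: hom_set_def)

lemma is_binprod_Obj:
  assumes "is_binprod C X Y K"
  shows "fst K \<in> Obj C" and "X \<in> Obj C" and "Y \<in> Obj C"
  using assms hom_Obj by (fastforce simp: is_binprod_def)+

lemma bmap_ex1:
  assumes K: "is_binprod C X Y (P, a, b)" and K': "is_binprod C X' Y' (P', a', b')"
    and x: "x \<in> hom_set C X X'" and y: "y \<in> hom_set C Y Y'"
  shows "\<exists>!m. m \<in> hom_set C P P' \<and> Cmp C a' m = Cmp C x a \<and> Cmp C b' m = Cmp C y b"
proof -
  have "Cmp C x a \<in> hom_set C P X'" "Cmp C y b \<in> hom_set C P Y'"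
    using K comp_in_hom x y by (auto simp: is_binprod_def)
  then show ?thesis using K' by (simp add: is_binprod_def)
qed

lemma bmap_eq:
  assumes "is_binprod C X Y (P, a, b)" and "is_binprod C X' Y' (P', a', b')"
    and "x \<in> hom_set C X X'" and "y \<in> hom_set C Y Y'"
    and "m \<in> hom_set C P P'" and "Cmp C a' m = Cmp C x a" and "Cmp C b' m = Cmp C y b"
  shows "bmap C (P, a, b) (P', a', b') x y = m"
  using the1_equality[OF bmap_ex1[OF assms(1-4)]] assms(5-7) by (simp add: bmap_def)

lemma bmap_props:
  assumes "is_binprod C X Y (P, a, b)" and "is_binprod C X' Y' (P', a', b')"
    and "x \<in> hom_set C X X'" and "y \<in> hom_set C Y Y'"
  defines "m \<equiv> bmap C (P, a, b) (P', a', b') x y"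
  shows "m \<in> hom_set C P P'" and "Cmp C a' m = Cmp C x a" and "Cmp C b' m = Cmp C y b"
  using theI'[OF bmap_ex1[OF assms(1-4)]] by (simp_all add: m_def bmap_def)

lemma bmap_hom:
  assumes "is_binprod C X Y K" and "is_binprod C X' Y' K'"
    and "x \<in> hom_set C X X'" and "y \<in> hom_set C Y Y'"
  shows "bmap C K K' x y \<in> hom_set C (fst K) (fst K')"
  using assms bmap_props(1) by (cases K; cases K') auto

lemma bmap_id:
  assumes "is_binprod C X Y K"
  shows "bmap C K K (Idn C X) (Idn C Y) = Idn C (fst K)"
proof -
  obtain P a b where K: "K = (P, a, b)" by (cases K)
  have a: "a \<in> hom_set C P X" and b: "b \<in> hom_set C P Y"
    using assms by (auto simp: K is_binprod_def)
  show ?thesis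
    using bmap_eq[OF assms[unfolded K] assms[unfolded K], of "Idn C X" "Idn C Y" "Idn C P"]
      id_in_hom hom_Obj a b comp_id[OF a] comp_id[OF b] id_comp[OF a] id_comp[OF b]
    by (metis K fst_conv)
qed

text \<open>The composite satisfies the two projection equations that characterize the right-hand
  side. Most commuting squares below are two instances of this equation whose right-hand sides
  coincide.\<close>

lemma bmap_comp:
  assumes "is_binprod C X Y K" and "is_binprod C X' Y' K'" and "is_binprod C X'' Y'' K''"
    and x: "x \<in> hom_set C X X'" and y: "y \<in> hom_set C Y Y'"
    and x': "x' \<in> hom_set C X' X''" and y': "y' \<in> hom_set C Y' Y''"
  shows "Cmp C (bmap C K' K'' x' y') (bmap C K K' x y) = bmap C K K'' (Cmp C x' x) (Cmp C y' y)"
proof -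
  obtain P a b P' a' b' P'' a'' b''
    where Ks: "K = (P, a, b)" "K' = (P', a', b')" "K'' = (P'', a'', b'')"
    by (cases K; cases K'; cases K'')
  note K = assms(1-3)[unfolded Ks]
  have p: "a \<in> hom_set C P X" "b \<in> hom_set C P Y" "a' \<in> hom_set C P' X'" "b' \<in> hom_set C P' Y'"
    "a'' \<in> hom_set C P'' X''" "b'' \<in> hom_set C P'' Y''"
    using K by (auto simp: is_binprod_def)
  note m = bmap_props[OF K(1,2) x y] and m' = bmap_props[OF K(2,3) x' y']
  let ?m = "bmap C (P, a, b) (P', a', b') x y" and ?m' = "bmap C (P', a', b') (P'', a'', b'') x' y'"
  have "Cmp C a'' (Cmp C ?m' ?m) = Cmp C (Cmp C x' x) a"
    using comp_assoc[OF m(1) m'(1) p(5)] comp_assoc[OF m(1) p(3) x'] comp_assoc[OF p(1) x x'] m m'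
    by simp
  moreover have "Cmp C b'' (Cmp C ?m' ?m) = Cmp C (Cmp C y' y) b"
    using comp_assoc[OF m(1) m'(1) p(6)] comp_assoc[OF m(1) p(4) y'] comp_assoc[OF p(2) y y'] m m'
    by simp
  ultimately show ?thesis
    unfolding Ks
    using bmap_eq[OF K(1,3) comp_in_hom[OF x x'] comp_in_hom[OF y y'] comp_in_hom[OF m(1) m'(1)]]
    by simp
qed

lemma comp_bmap_comp:
  assumes "is_binprod C X Y K" and "is_binprod C X' Y' K'" and "is_binprod C X'' Y'' K''"
    and "x \<in> hom_set C X X'" and "y \<in> hom_set C Y Y'"
    and "x' \<in> hom_set C X' X''" and "y' \<in> hom_set C Y' Y''" and "g \<in> hom_set C (fst K'') Z"
  shows "Cmp C (Cmp C g (bmap C K' K'' x' y')) (bmap C K K' x y) =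
    Cmp C g (bmap C K K'' (Cmp C x' x) (Cmp C y' y))"
  using comp_assoc[OF bmap_hom[OF assms(1,2,4,5)] bmap_hom[OF assms(2,3,6,7)] assms(8)]
    bmap_comp[OF assms(1-7)] by simp

section \<open>Products of families and their reduction to binary products\<close>

lemma is_product_ex1:
  assumes "is_product C I A P p" and "W \<in> Obj C" and "\<forall>j\<in>I. f j \<in> hom_set C W (A j)"
  shows "\<exists>!m. m \<in> hom_set C W P \<and> (\<forall>j\<in>I. Cmp C (p j) m = f j)"
  using assms by (simp add: is_product_def)

text \<open>Both arrows factor the family of composites of \<open>t\<close> with the projections.
  For empty \<open>I\<close> this says that any two parallel arrows into a terminal object agree,
  which is how \<open>empty_prod_colimit\<close> uses it.\<close>

lemma is_product_ext:
  assumes P: "is_product C I A P p" and s: "s \<in> hom_set C W P" and t: "t \<in> hom_set C W P"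
    and "\<And>j. j \<in> I \<Longrightarrow> Cmp C (p j) s = Cmp C (p j) t"
  shows "s = t"
proof -
  have "\<forall>j\<in>I. Cmp C (p j) t \<in> hom_set C W (A j)"
    using P comp_in_hom[OF t] by (simp add: is_product_def)
  from is_product_ex1[OF P hom_Obj(1)[OF t] this]
  have uniq: "m = m'"
    if "m \<in> hom_set C W P \<and> (\<forall>j\<in>I. Cmp C (p j) m = Cmp C (p j) t)"
      "m' \<in> hom_set C W P \<and> (\<forall>j\<in>I. Cmp C (p j) m' = Cmp C (p j) t)" for m m'
    using that unfolding Ex1_def by (elim exE conjE) metis
  show ?thesis
    by (rule uniq) (simp_all add: assms)
qed

lemma is_binprod_if_is_product:
  assumes "is_product C {1..2::nat} A P p"
  shows "is_binprod C (A 1) (A 2) (P, p 1, p 2)"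
proof -
  have I: "{1..2::nat} = {1, 2}" by auto
  note P = assms[unfolded I]
  have "\<exists>!m. m \<in> hom_set C W P \<and> Cmp C (p 1) m = f \<and> Cmp C (p 2) m = g"
    if f: "f \<in> hom_set C W (A 1)" and g: "g \<in> hom_set C W (A 2)" for W f g
  proof -
    have "\<forall>j\<in>{1, 2}. (if j = 1 then f else g) \<in> hom_set C W (A j)"
      using f g by simp
    from is_product_ex1[OF P hom_Obj(1)[OF f] this] show ?thesis by simp
  qed
  then show ?thesis using P by (simp add: is_binprod_def is_product_def)
qed

text \<open>The arrow \<open>a\<close> drops the factor \<open>k\<close>. An arrow into
  \<open>R\<close> is a family over \<open>I\<close>, so a pair of arrows into \<open>R\<close> and
  \<open>A k\<close> carries the same data as a family over \<open>insert k I\<close>.\<close>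

lemma is_binprod_insert:
  assumes P: "is_product C (insert k I) A P p" and R: "is_product C I A R s" and "k \<notin> I"
    and a: "a \<in> hom_set C P R" "\<And>j. j \<in> I \<Longrightarrow> Cmp C (s j) a = p j"
  shows "is_binprod C R (A k) (P, a, p k)"
proof -
  have pk: "p k \<in> hom_set C P (A k)"
    using P by (simp add: is_product_def)
  have s: "s j \<in> hom_set C R (A j)" if "j \<in> I" for j
    using R that by (simp add: is_product_def)
  have "\<exists>!m. m \<in> hom_set C W P \<and> Cmp C a m = f \<and> Cmp C (p k) m = g"
    if f: "f \<in> hom_set C W R" and g: "g \<in> hom_set C W (A k)" for W f g
  proof -
    \<comment> \<open>The pair \<open>(f, g)\<close> as one family over \<open>insert k I\<close>;
      since \<open>k \<notin> I\<close>, the index \<open>k\<close> does not override a component of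
      \<open>f\<close>.\<close>
    define h where "h j = (if j = k then g else Cmp C (s j) f)" for j
    have "\<forall>j\<in>insert k I. h j \<in> hom_set C W (A j)"
      using g comp_in_hom[OF f s] by (simp add: h_def)
    from is_product_ex1[OF P hom_Obj(1)[OF f] this]
    obtain m where m: "m \<in> hom_set C W P" "\<And>j. j \<in> insert k I \<Longrightarrow> Cmp C (p j) m = h j"
      by (elim ex1E) auto
    have "Cmp C a m = f"
    proof (rule is_product_ext[OF R comp_in_hom[OF m(1) a(1)] f])
      fix j assume j: "j \<in> I"
      then have "Cmp C (s j) (Cmp C a m) = Cmp C (p j) m"
        using comp_assoc[OF m(1) a(1) s[OF j]] a(2) by simp
      then show "Cmp C (s j) (Cmp C a m) = Cmp C (s j) f"
        using m(2)[of j] j \<open>k \<notin> I\<close> by (cases "j = k") (simp_all add: h_def)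
    qed
    moreover have "m' = m"
      if m': "m' \<in> hom_set C W P" "Cmp C a m' = f" "Cmp C (p k) m' = g" for m'
    proof (rule is_product_ext[OF P m'(1) m(1)])
      fix j assume j: "j \<in> insert k I"
      show "Cmp C (p j) m' = Cmp C (p j) m"
      proof (cases "j = k")
        case True
        then show ?thesis using m(2)[OF j] m'(3) by (simp add: h_def)
      next
        case False
        then have "j \<in> I" using j by simp
        then have "Cmp C (p j) m' = Cmp C (s j) f"
          using comp_assoc[OF m'(1) a(1) s] a(2) m'(2) by simp
        then show ?thesis using m(2)[OF j] False by (simp add: h_def)
      qed
    qed
    moreover have "Cmp C (p k) m = g" using m(2)[of k] by (simp add: h_def)
    ultimately show ?thesis using m(1) by blast
  qed
  then show ?thesis using a(1) pk by (simp add: is_binprod_def)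
qed


section \<open>Products of functors\<close>

lemma prod_arr:
  assumes P: "is_product C I A P p" and Q: "is_product C I B Q q"
    and f: "\<And>j. j \<in> I \<Longrightarrow> f j \<in> hom_set C (A j) (B j)"
  shows "prod_arr C I P p Q q f \<in> hom_set C P Q"
    and "j \<in> I \<Longrightarrow> Cmp C (q j) (prod_arr C I P p Q q f) = Cmp C (f j) (p j)"
proof -
  have "\<forall>j\<in>I. Cmp C (f j) (p j) \<in> hom_set C P (B j)"
    using P comp_in_hom[OF _ f] by (simp add: is_product_def)
  moreover have "P \<in> Obj C" using P by (simp add: is_product_def)
  ultimately have "\<exists>!m. m \<in> hom_set C P Q \<and> (\<forall>j\<in>I. Cmp C (q j) m = Cmp C (f j) (p j))"
    by (intro is_product_ex1[OF Q])
  from theI'[OF this] show "prod_arr C I P p Q q f \<in> hom_set C P Q"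
    and "j \<in> I \<Longrightarrow> Cmp C (q j) (prod_arr C I P p Q q f) = Cmp C (f j) (p j)"
    unfolding prod_arr_def by blast+
qed

lemma prod_functor_arr:
  assumes F: "\<And>j. j \<in> I \<Longrightarrow> cat_functor J C (F j)"
    and P: "\<And>d. d \<in> Obj J \<Longrightarrow> is_product C I (\<lambda>j. FObj (F j) d) (P d) (p d)"
    and J: "category J" and x: "x \<in> hom_set J d d'"
  shows "FArr (prod_functor J C I F P p) x \<in> hom_set C (P d) (P d')"
    and "j \<in> I \<Longrightarrow> Cmp C (p d' j) (FArr (prod_functor J C I F P p) x) =
      Cmp C (FArr (F j) x) (p d j)"
proof -
  have d: "Dom J x = d" "Cod J x = d'" using x by (auto simp: hom_set_def)
  have dO: "d \<in> Obj J" "d' \<in> Obj J" using category.hom_Obj[OF J x] by auto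
  note * = prod_arr[OF P[OF dO(1)] P[OF dO(2)], of "\<lambda>j. FArr (F j) x",
      OF cat_functor.arr_map[OF F x]]
  show "FArr (prod_functor J C I F P p) x \<in> hom_set C (P d) (P d')"
    and "j \<in> I \<Longrightarrow> Cmp C (p d' j) (FArr (prod_functor J C I F P p) x) =
      Cmp C (FArr (F j) x) (p d j)"
    using * by (simp_all add: prod_functor_def d)
qed

text \<open>Arrows into a product are compared projection by projection, so each functor law reduces
  to the same law for the factors \<open>F j\<close>.\<close>

lemma cat_functor_prod_functor:
  assumes F: "\<And>j. j \<in> I \<Longrightarrow> cat_functor J C (F j)"
    and P: "\<And>d. d \<in> Obj J \<Longrightarrow> is_product C I (\<lambda>j. FObj (F j) d) (P d) (p d)"
    and J: "category J"
  shows "cat_functor J C (prod_functor J C I F P p)" (is "cat_functor J C ?F")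
proof -
  interpret J: category J by (fact J)
  have ob: "FObj ?F = P" by (simp add: prod_functor_def)
  note arr = prod_functor_arr[where F = F and P = P and p = p, OF F P J]
  have p: "p d j \<in> hom_set C (P d) (FObj (F j) d)" if "d \<in> Obj J" "j \<in> I" for d j
    using P[OF that(1)] that(2) by (simp add: is_product_def)
  show ?thesis
  proof
    fix X assume X: "X \<in> Obj J"
    show PX: "FObj ?F X \<in> Obj C" using P[OF X] by (simp add: ob is_product_def)
    show "FArr ?F (Idn J X) = Idn C (FObj ?F X)"
    proof (rule is_product_ext[OF P[OF X]])
      show "FArr ?F (Idn J X) \<in> hom_set C (P X) (P X)"
        using arr(1)[OF _ _ J.id_in_hom[OF X]] by simp
      show "Idn C (FObj ?F X) \<in> hom_set C (P X) (P X)"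
        using id_in_hom[OF PX] by (simp add: ob)
      fix j assume j: "j \<in> I"
      show "Cmp C (p X j) (FArr ?F (Idn J X)) = Cmp C (p X j) (Idn C (FObj ?F X))"
        using arr(2)[OF _ _ J.id_in_hom[OF X] j] cat_functor.preserves_id[OF F[OF j] X]
          id_comp[OF p[OF X j]] comp_id[OF p[OF X j]] by (simp add: ob)
    qed
  next
    fix f X Y assume "f \<in> hom_set J X Y"
    then show "FArr ?F f \<in> hom_set C (FObj ?F X) (FObj ?F Y)"
      using arr(1) by (simp add: ob)
  next
    fix f g X Y Z assume f: "f \<in> hom_set J X Y" and g: "g \<in> hom_set J Y Z"
    have gf: "Cmp J g f \<in> hom_set J X Z" using f g J.comp_in_hom by blast
    have O: "X \<in> Obj J" "Y \<in> Obj J" "Z \<in> Obj J"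
      using J.hom_Obj f g by blast+
    have af: "FArr ?F f \<in> hom_set C (P X) (P Y)" using arr(1)[OF _ _ f] by simp
    have ag: "FArr ?F g \<in> hom_set C (P Y) (P Z)" using arr(1)[OF _ _ g] by simp
    show "FArr ?F (Cmp J g f) = Cmp C (FArr ?F g) (FArr ?F f)"
    proof (rule is_product_ext[OF P[OF O(3)]])
      show "FArr ?F (Cmp J g f) \<in> hom_set C (P X) (P Z)" using arr(1)[OF _ _ gf] by simp
      show "Cmp C (FArr ?F g) (FArr ?F f) \<in> hom_set C (P X) (P Z)"
        by (rule comp_in_hom[OF af ag])
      fix j assume j: "j \<in> I"
      note Ff = cat_functor.arr_map[OF F[OF j] f] and Fg = cat_functor.arr_map[OF F[OF j] g]
      have "Cmp C (p Z j) (Cmp C (FArr ?F g) (FArr ?F f)) =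
          Cmp C (Cmp C (FArr (F j) g) (p Y j)) (FArr ?F f)"
        using comp_assoc[OF af ag p[OF O(3) j]] arr(2)[OF _ _ g j] by simp
      also have "\<dots> = Cmp C (FArr (F j) g) (Cmp C (FArr (F j) f) (p X j))"
        using comp_assoc[OF af p[OF O(2) j] Fg] arr(2)[OF _ _ f j] by simp
      also have "\<dots> = Cmp C (FArr (F j) (Cmp J g f)) (p X j)"
        using comp_assoc[OF p[OF O(1) j] Ff Fg] cat_functor.preserves_comp[OF F[OF j] f g] by simp
      finally show "Cmp C (p Z j) (FArr ?F (Cmp J g f)) =
          Cmp C (p Z j) (Cmp C (FArr ?F g) (FArr ?F f))"
        using arr(2)[OF _ _ gf j] by simp
    qed
  qed
qed

lemma is_cocone_prod:
  assumes F: "\<And>j. j \<in> I \<Longrightarrow> is_cocone J C (F j) (L j) (c j)"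
    and P: "\<And>d. d \<in> Obj J \<Longrightarrow> is_product C I (\<lambda>j. FObj (F j) d) (P d) (p d)"
    and Q: "is_product C I L Q q" and J: "category J"
  shows "is_cocone J C (prod_functor J C I F P p) Q
    (\<lambda>d. prod_arr C I (P d) (p d) Q q (\<lambda>j. c j d))" (is "is_cocone J C ?F Q ?m")
proof -
  interpret J: category J by (fact J)
  have ob: "FObj ?F = P" by (simp add: prod_functor_def)
  have fun_F: "\<And>j. j \<in> I \<Longrightarrow> cat_functor J C (F j)" using F by (simp add: is_cocone_def)
  have c: "c j d \<in> hom_set C (FObj (F j) d) (L j)" if "d \<in> Obj J" "j \<in> I" for d j
    using F[OF that(2)] that(1) by (simp add: is_cocone_def)
  have p: "p d j \<in> hom_set C (P d) (FObj (F j) d)" if "d \<in> Obj J" "j \<in> I" for d j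
    using P[OF that(1)] that(2) by (simp add: is_product_def)
  have q: "q j \<in> hom_set C Q (L j)" if "j \<in> I" for j
    using Q that by (simp add: is_product_def)
  have m: "?m d \<in> hom_set C (P d) Q"
    and qm: "\<And>j. j \<in> I \<Longrightarrow> Cmp C (q j) (?m d) = Cmp C (c j d) (p d j)" if "d \<in> Obj J" for d
    using prod_arr[OF P[OF that] Q, of "\<lambda>j. c j d"] c[OF that] by blast+
  note arr = prod_functor_arr[where F = F and P = P and p = p, OF fun_F P J]
  have "Cmp C (?m (Cod J x)) (FArr ?F x) = ?m (Dom J x)" if x: "x \<in> Arr J" for x
  proof -
    define d d' where "d = Dom J x" and "d' = Cod J x"
    have x': "x \<in> hom_set J d d'" using x by (simp add: hom_set_def d_def d'_def)
    have O: "d \<in> Obj J" "d' \<in> Obj J" using J.hom_Obj x' by blast+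
    have ax: "FArr ?F x \<in> hom_set C (P d) (P d')" using arr(1)[OF _ _ x'] by simp
    have "Cmp C (?m d') (FArr ?F x) = ?m d"
    proof (rule is_product_ext[OF Q comp_in_hom[OF ax m[OF O(2)]] m[OF O(1)]])
      fix j assume j: "j \<in> I"
      note Fx = cat_functor.arr_map[OF fun_F[OF j] x']
      have "Cmp C (q j) (Cmp C (?m d') (FArr ?F x)) =
          Cmp C (Cmp C (c j d') (p d' j)) (FArr ?F x)"
        using comp_assoc[OF ax m[OF O(2)] q[OF j]] qm[OF O(2) j] by simp
      also have "\<dots> = Cmp C (c j d') (Cmp C (FArr (F j) x) (p d j))"
        using comp_assoc[OF ax p[OF O(2) j] c[OF O(2) j]] arr(2)[OF _ _ x' j] by simp
      also have "\<dots> = Cmp C (Cmp C (c j d') (FArr (F j) x)) (p d j)"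
        by (rule comp_assoc[OF p[OF O(1) j] Fx c[OF O(2) j]])
      also have "Cmp C (c j d') (FArr (F j) x) = c j d"
        using F[OF j] x by (simp add: is_cocone_def d_def d'_def)
      finally show "Cmp C (q j) (Cmp C (?m d') (FArr ?F x)) = Cmp C (q j) (?m d)"
        using qm[OF O(1) j] by simp
    qed
    then show ?thesis by (simp add: d_def d'_def)
  qed
  then show ?thesis
    using cat_functor_prod_functor[OF fun_F P J] Q m
    by (simp add: is_cocone_def is_product_def ob)
qed


section \<open>Multiplication with an object preserves colimits\<close>

text \<open>The functor with the right adjoint sends \<open>s\<close> to an arrow with the same
  projections as \<open>bmap\<close> of \<open>s\<close> and the identity of \<open>Y\<close>. This
  turns the adjunction into a statement about cones, with naturality kept in the variable
  \<open>X\<close>, the one in which colimits are taken.\<close>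

lemma cartesian_closed_curry:
  assumes "cartesian_closed C" and Y: "Y \<in> Obj C"
  obtains K G \<phi> where
    "\<forall>X\<in>Obj C. is_binprod C X Y (K X)"
    and "\<forall>Z\<in>Obj C. G Z \<in> Obj C"
    and "\<forall>X\<in>Obj C. \<forall>Z\<in>Obj C.
      bij_betw (\<phi> X Z) (hom_set C (fst (K X)) Z) (hom_set C X (G Z))"
    and "\<forall>X' X Z s h. s \<in> hom_set C X' X \<longrightarrow> h \<in> hom_set C (fst (K X)) Z \<longrightarrow>
      \<phi> X' Z (Cmp C h (bmap C (K X') (K X) s (Idn C Y))) = Cmp C (\<phi> X Z h) s"
proof -
  let ?T = "times_family C Y"
  obtain P p where
    P: "\<And>X. X \<in> Obj C \<Longrightarrow> is_product C {1..2} (\<lambda>j. FObj (?T j) X) (P X) (p X)"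
    and adj: "has_right_adjoint C C (prod_functor C C {1..2} ?T P p)" (is "has_right_adjoint C C ?F")
    using assms unfolding cartesian_closed_def by blast
  obtain G :: "('o, 'm, 'o, 'm) cat_functor" and \<phi> where G: "cat_functor C C G"
    and bij: "\<And>X Z. X \<in> Obj C \<Longrightarrow> Z \<in> Obj C \<Longrightarrow>
        bij_betw (\<phi> X Z) (hom_set C (FObj ?F X) Z) (hom_set C X (FObj G Z))"
    and nat: "\<And>X' X Z Z' s k h. X' \<in> Obj C \<Longrightarrow> X \<in> Obj C \<Longrightarrow> Z \<in> Obj C \<Longrightarrow> Z' \<in> Obj C \<Longrightarrow>
        s \<in> hom_set C X' X \<Longrightarrow> k \<in> hom_set C Z Z' \<Longrightarrow> h \<in> hom_set C (FObj ?F X) Z \<Longrightarrow>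
        \<phi> X' Z' (Cmp C k (Cmp C h (FArr ?F s))) = Cmp C (FArr G k) (Cmp C (\<phi> X Z h) s)"
    using adj unfolding has_right_adjoint_def by blast
  have ob: "FObj ?F = P" by (simp add: prod_functor_def)
  have T: "FObj (?T 1) X = X" "FObj (?T 2) X = Y" "FArr (?T 1) f = f" "FArr (?T 2) f = Idn C Y"
    for X f
    by (simp_all add: times_family_def id_functor_def const_functor_def)
  have fun_T: "cat_functor C C (?T j)" for j
    using id_in_hom[OF Y] id_comp[OF id_in_hom[OF Y]] Y
    by unfold_locales (auto simp: times_family_def id_functor_def const_functor_def)
  define K where "K X = (P X, p X 1, p X 2)" for X
  have K: "is_binprod C X Y (K X)" if "X \<in> Obj C" for X
    using is_binprod_if_is_product[OF P[OF that]] by (simp only: T K_def)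
  have Gob: "\<forall>Z\<in>Obj C. FObj G Z \<in> Obj C" using cat_functor.obj_map[OF G] by blast
  have bij': "\<forall>X\<in>Obj C. \<forall>Z\<in>Obj C.
      bij_betw (\<phi> X Z) (hom_set C (fst (K X)) Z) (hom_set C X (FObj G Z))"
    using bij unfolding ob K_def fst_conv by blast
  have "\<phi> X' Z (Cmp C h (bmap C (K X') (K X) s (Idn C Y))) = Cmp C (\<phi> X Z h) s"
    if s: "s \<in> hom_set C X' X" and h: "h \<in> hom_set C (fst (K X)) Z" for X' X Z s h
  proof -
    have O: "X' \<in> Obj C" "X \<in> Obj C" "Z \<in> Obj C" using hom_Obj s h by blast+
    note arr = prod_functor_arr[where F = ?T and P = P and p = p, OF fun_T P category_axioms s]
    have Fs: "FArr ?F s \<in> hom_set C (P X') (P X)" using arr(1) by simp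
    have "bmap C (K X') (K X) s (Idn C Y) = FArr ?F s"
      unfolding K_def
    proof (rule bmap_eq[OF K[OF O(1), unfolded K_def] K[OF O(2), unfolded K_def] s id_in_hom[OF Y] Fs])
      show "Cmp C (p X 1) (FArr ?F s) = Cmp C s (p X' 1)"
        using arr(2)[of 1] by (simp only: T) simp
      show "Cmp C (p X 2) (FArr ?F s) = Cmp C (Idn C Y) (p X' 2)"
        using arr(2)[of 2] by (simp only: T) simp
    qed
    moreover have "\<phi> X Z h \<in> hom_set C X (FObj G Z)"
      using bij' O(2,3) h bij_betwE by blast
    moreover have hP: "h \<in> hom_set C (P X) Z" using h by (simp add: K_def)
    \<comment> \<open>Naturality is applied with the identity of \<open>Z\<close> as arrow in the
      second variable; \<open>G\<close> sends it to an identity, which cancels.\<close>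
    ultimately show ?thesis
      using nat[OF O(1,2,3,3) s id_in_hom[OF O(3)], unfolded ob, OF hP]
        cat_functor.preserves_id[OF G O(3)] id_comp comp_in_hom[OF Fs hP] comp_in_hom[OF s]
      by metis
  qed
  then show thesis
    using that[of K "FObj G" \<phi>] K Gob bij' by simp
qed

lemma colimit_factor:
  assumes "is_colimit_cocone J C F L c" and "\<And>d. d \<in> Obj J \<Longrightarrow> g d \<in> hom_set C (FObj F d) Z"
    and "\<And>d d' x. x \<in> hom_set J d d' \<Longrightarrow> Cmp C (g d') (FArr F x) = g d" and "Z \<in> Obj C"
  shows "\<exists>!u. u \<in> hom_set C L Z \<and> (\<forall>d\<in>Obj J. Cmp C u (c d) = g d)"
proof -
  have "is_cocone J C F Z g"
    using assms by (auto simp: is_colimit_cocone_def is_cocone_def hom_set_def)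
  then show ?thesis using assms(1) by (auto simp: is_colimit_cocone_def)
qed

text \<open>The composites of \<open>v\<close> with the legs form a cocone that both
  \<open>u\<close> and \<open>v\<close> factor.\<close>

lemma colimit_ext:
  assumes colim: "is_colimit_cocone J C F L c" and "u \<in> hom_set C L Z" and v: "v \<in> hom_set C L Z"
    and "\<And>d. d \<in> Obj J \<Longrightarrow> Cmp C u (c d) = Cmp C v (c d)"
  shows "u = v"
proof -
  have cocone: "is_cocone J C F L c" using colim by (simp add: is_colimit_cocone_def)
  then interpret F: cat_functor J C F by (simp add: is_cocone_def)
  have c: "c d \<in> hom_set C (FObj F d) L" if "d \<in> Obj J" for d
    using cocone that by (simp add: is_cocone_def)
  have "\<exists>!w. w \<in> hom_set C L Z \<and> (\<forall>d\<in>Obj J. Cmp C w (c d) = Cmp C v (c d))"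
  proof (rule colimit_factor[OF colim])
    show "Z \<in> Obj C" using hom_Obj v by blast
    show "Cmp C v (c d) \<in> hom_set C (FObj F d) Z" if "d \<in> Obj J" for d
      using comp_in_hom c that v by blast
    show "Cmp C (Cmp C v (c d')) (FArr F x) = Cmp C v (c d)" if x: "x \<in> hom_set J d d'" for d d' x
    proof -
      have "Cmp C (c d') (FArr F x) = c d"
        using cocone x by (auto simp: is_cocone_def hom_set_def)
      then show ?thesis
        using comp_assoc[OF F.arr_map[OF x] c v] F.A.hom_Obj[OF x] by simp
    qed
  qed
  then show ?thesis using assms by blast
qed

text \<open>Transposition along \<phi> turns arrows out of the product of \<open>L\<close> and
  \<open>Y\<close> into arrows out of \<open>L\<close>, where the universal property of the colimit
  applies. Uniqueness comes from injectivity of \<phi>, existence from its surjectivity. The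
  formulation by legs avoids building the functor that multiplies \<open>F\<close> by
  \<open>Y\<close>.\<close>

lemma
  assumes ccc: "cartesian_closed C" and colim: "is_colimit_cocone J C F L c"
    and K: "\<And>d. d \<in> Obj J \<Longrightarrow> is_binprod C (FObj F d) Y (K d)"
    and Q: "is_binprod C L Y Q"
  shows times_colimit_ext:
    "\<And>u v Z. u \<in> hom_set C (fst Q) Z \<Longrightarrow> v \<in> hom_set C (fst Q) Z \<Longrightarrow>
      (\<And>d. d \<in> Obj J \<Longrightarrow> Cmp C u (bmap C (K d) Q (c d) (Idn C Y)) =
        Cmp C v (bmap C (K d) Q (c d) (Idn C Y))) \<Longrightarrow> u = v"
    and times_colimit_factor:
    "\<And>g Z. Z \<in> Obj C \<Longrightarrow> (\<And>d. d \<in> Obj J \<Longrightarrow> g d \<in> hom_set C (fst (K d)) Z) \<Longrightarrow>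
      (\<And>d d' x. x \<in> hom_set J d d' \<Longrightarrow>
        Cmp C (g d') (bmap C (K d) (K d') (FArr F x) (Idn C Y)) = g d) \<Longrightarrow>
      \<exists>u. u \<in> hom_set C (fst Q) Z \<and>
        (\<forall>d\<in>Obj J. Cmp C u (bmap C (K d) Q (c d) (Idn C Y)) = g d)"
proof -
  have cocone: "is_cocone J C F L c" using colim by (simp add: is_colimit_cocone_def)
  then interpret F: cat_functor J C F by (simp add: is_cocone_def)
  have c: "c d \<in> hom_set C (FObj F d) L" if "d \<in> Obj J" for d
    using cocone that by (simp add: is_cocone_def)
  have LO: "L \<in> Obj C" using cocone by (simp add: is_cocone_def)
  have YO: "Y \<in> Obj C" using is_binprod_Obj[OF Q] by blast
  obtain K0 G \<phi> where
    K0: "\<forall>X\<in>Obj C. is_binprod C X Y (K0 X)"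
    and G: "\<forall>Z\<in>Obj C. G Z \<in> Obj C"
    and bij: "\<forall>X\<in>Obj C. \<forall>Z\<in>Obj C.
      bij_betw (\<phi> X Z) (hom_set C (fst (K0 X)) Z) (hom_set C X (G Z))"
    and nat: "\<forall>X' X Z s h. s \<in> hom_set C X' X \<longrightarrow> h \<in> hom_set C (fst (K0 X)) Z \<longrightarrow>
      \<phi> X' Z (Cmp C h (bmap C (K0 X') (K0 X) s (Idn C Y))) = Cmp C (\<phi> X Z h) s"
    using cartesian_closed_curry[OF ccc YO] .
  note K0 = K0[rule_format] and G = G[rule_format] and bij = bij[rule_format]
    and nat = nat[rule_format]
  note F0 = K0[OF F.obj_map] and L0 = K0[OF LO]
  note iY = id_in_hom[OF YO] and iL = id_in_hom[OF LO] and iF = id_in_hom[OF F.obj_map]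
  have [simp]: "Cmp C (Idn C Y) (Idn C Y) = Idn C Y" using id_comp[OF iY] .
  have [simp]: "Cmp C (Idn C L) (Idn C L) = Idn C L" using id_comp[OF iL] .
  have [simp]: "Cmp C (c d) (Idn C (FObj F d)) = c d" "Cmp C (Idn C L) (c d) = c d"
    if "d \<in> Obj J" for d
    using comp_id[OF c[OF that]] id_comp[OF c[OF that]] .
  \<comment> \<open>The bijections live on the cones \<open>K0\<close>, the claims on
    \<open>K\<close> and \<open>Q\<close>. The arrows \<open>i\<close>, \<open>j\<close>,
    \<open>ii d\<close>, \<open>jj d\<close> translate between them, and \<open>ik\<close> and
    \<open>jm\<close> say that the translations respect the legs \<open>k d\<close> and
    \<open>m d\<close>.\<close>
  define i j where "i = bmap C (K0 L) Q (Idn C L) (Idn C Y)"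
    and "j = bmap C Q (K0 L) (Idn C L) (Idn C Y)"
  define ii jj where "ii d = bmap C (K0 (FObj F d)) (K d) (Idn C (FObj F d)) (Idn C Y)"
    and "jj d = bmap C (K d) (K0 (FObj F d)) (Idn C (FObj F d)) (Idn C Y)" for d
  define k m where "k d = bmap C (K0 (FObj F d)) (K0 L) (c d) (Idn C Y)"
    and "m d = bmap C (K d) Q (c d) (Idn C Y)" for d
  have i: "i \<in> hom_set C (fst (K0 L)) (fst Q)" unfolding i_def by (rule bmap_hom[OF L0 Q iL iY])
  have j: "j \<in> hom_set C (fst Q) (fst (K0 L))" unfolding j_def by (rule bmap_hom[OF Q L0 iL iY])
  have ij: "Cmp C i j = Idn C (fst Q)"
    unfolding i_def j_def by (simp add: bmap_comp[OF Q L0 Q iL iY iL iY] bmap_id[OF Q])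
  have ii: "ii d \<in> hom_set C (fst (K0 (FObj F d))) (fst (K d))" if "d \<in> Obj J" for d
    unfolding ii_def by (rule bmap_hom[OF F0 K iF iY]) (fact that)+
  have jj: "jj d \<in> hom_set C (fst (K d)) (fst (K0 (FObj F d)))" if "d \<in> Obj J" for d
    unfolding jj_def by (rule bmap_hom[OF K F0 iF iY]) (fact that)+
  have k: "k d \<in> hom_set C (fst (K0 (FObj F d))) (fst (K0 L))" if "d \<in> Obj J" for d
    unfolding k_def by (rule bmap_hom[OF F0 L0 c iY]) (fact that)+
  have m: "m d \<in> hom_set C (fst (K d)) (fst Q)" if "d \<in> Obj J" for d
    unfolding m_def by (rule bmap_hom[OF K Q c iY]) (fact that)+
  have iijj: "Cmp C (ii d) (jj d) = Idn C (fst (K d))" if d: "d \<in> Obj J" for d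
    unfolding ii_def jj_def
    using bmap_comp[OF K[OF d] F0[OF d] K[OF d] iF[OF d] iY iF[OF d] iY] bmap_id[OF K[OF d]]
      id_comp[OF iF[OF d]] by simp
  have ik: "Cmp C i (k d) = Cmp C (m d) (ii d)" if d: "d \<in> Obj J" for d
    unfolding i_def k_def m_def ii_def
    using bmap_comp[OF F0[OF d] L0 Q c[OF d] iY iL iY]
      bmap_comp[OF F0[OF d] K[OF d] Q iF[OF d] iY c[OF d] iY] d by simp
  have jm: "Cmp C j (m d) = Cmp C (k d) (jj d)" if d: "d \<in> Obj J" for d
    unfolding j_def k_def m_def jj_def
    using bmap_comp[OF K[OF d] Q L0 c[OF d] iY iL iY]
      bmap_comp[OF K[OF d] F0[OF d] L0 iF[OF d] iY c[OF d] iY] d by simp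
  have \<phi>k: "\<phi> (FObj F d) Z (Cmp C h (k d)) = Cmp C (\<phi> L Z h) (c d)"
    if "d \<in> Obj J" "h \<in> hom_set C (fst (K0 L)) Z" for d h Z
    unfolding k_def by (rule nat[OF c that(2)]) (fact that)
  show "u = v"
    if u: "u \<in> hom_set C (fst Q) Z" and v: "v \<in> hom_set C (fst Q) Z"
      and uv0: "\<And>d. d \<in> Obj J \<Longrightarrow> Cmp C u (bmap C (K d) Q (c d) (Idn C Y)) =
        Cmp C v (bmap C (K d) Q (c d) (Idn C Y))"
    for u v Z
  proof -
    have uv: "Cmp C u (m d) = Cmp C v (m d)" if "d \<in> Obj J" for d
      unfolding m_def by (rule uv0[OF that])
    have ZO: "Z \<in> Obj C" using hom_Obj u by blast
    note ui = comp_in_hom[OF i u] and vi = comp_in_hom[OF i v]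
    \<comment> \<open>Since \<open>i\<close> after \<open>j\<close> is an identity, it suffices to
      compare \<open>u\<close> and \<open>v\<close> after precomposition with \<open>i\<close>,
      where transposition is available.\<close>
    have "\<phi> L Z (Cmp C u i) = \<phi> L Z (Cmp C v i)"
    proof (rule colimit_ext[OF colim])
      show "\<phi> L Z (Cmp C u i) \<in> hom_set C L (G Z)" "\<phi> L Z (Cmp C v i) \<in> hom_set C L (G Z)"
        using bij[OF LO ZO] ui vi by (auto simp: bij_betw_def)
      fix d assume d: "d \<in> Obj J"
      have "Cmp C (Cmp C w i) (k d) = Cmp C (Cmp C w (m d)) (ii d)"
        if w: "w \<in> hom_set C (fst Q) Z" for w
        using comp_assoc[OF k[OF d] i w] comp_assoc[OF ii[OF d] m[OF d] w] ik[OF d] by simp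
      from this[OF u] this[OF v] have "Cmp C (Cmp C u i) (k d) = Cmp C (Cmp C v i) (k d)"
        by (simp add: uv[OF d])
      then show "Cmp C (\<phi> L Z (Cmp C u i)) (c d) = Cmp C (\<phi> L Z (Cmp C v i)) (c d)"
        using \<phi>k[OF d ui] \<phi>k[OF d vi] by simp
    qed
    then have "Cmp C u i = Cmp C v i"
      using bij[OF LO ZO] ui vi by (auto simp: bij_betw_def dest: inj_onD)
    then show ?thesis
      using comp_assoc[OF j i u] comp_assoc[OF j i v] ij comp_id[OF u] comp_id[OF v] by simp
  qed
  show "\<exists>u. u \<in> hom_set C (fst Q) Z \<and>
      (\<forall>d\<in>Obj J. Cmp C u (bmap C (K d) Q (c d) (Idn C Y)) = g d)"
    if ZO: "Z \<in> Obj C" and g: "\<And>d. d \<in> Obj J \<Longrightarrow> g d \<in> hom_set C (fst (K d)) Z"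
      and compat: "\<And>d d' x. x \<in> hom_set J d d' \<Longrightarrow>
        Cmp C (g d') (bmap C (K d) (K d') (FArr F x) (Idn C Y)) = g d"
    for g Z
  proof -
    \<comment> \<open>The transpose of \<open>g d\<close>, which is first moved to the cone on which
      \<phi> is defined.\<close>
    define w where "w d = \<phi> (FObj F d) Z (Cmp C (g d) (ii d))" for d
    have "\<exists>!u. u \<in> hom_set C L (G Z) \<and> (\<forall>d\<in>Obj J. Cmp C u (c d) = w d)"
    proof (rule colimit_factor[OF colim])
      show "G Z \<in> Obj C" by (rule G[OF ZO])
      show "w d \<in> hom_set C (FObj F d) (G Z)" if "d \<in> Obj J" for d
        using bij[OF F.obj_map[OF that] ZO] comp_in_hom[OF ii g] that
        by (auto simp: bij_betw_def w_def)
      fix d d' x assume x: "x \<in> hom_set J d d'"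
      have d: "d \<in> Obj J" and d': "d' \<in> Obj J" using F.A.hom_Obj[OF x] by auto
      note Fx = F.arr_map[OF x]
      \<comment> \<open>Passing from the chosen cones to the given ones may happen before or after
        the transition arrow. Done before, it exposes the compatibility of \<open>g\<close>.\<close>
      have "Cmp C (Cmp C (g d') (ii d')) (bmap C (K0 (FObj F d)) (K0 (FObj F d')) (FArr F x) (Idn C Y))
          = Cmp C (g d') (bmap C (K0 (FObj F d)) (K d') (FArr F x) (Idn C Y))"
        unfolding ii_def
        using comp_bmap_comp[OF F0[OF d] F0[OF d'] K[OF d'] Fx iY iF[OF d'] iY g[OF d']]
        by (simp add: id_comp[OF Fx])
      also have "\<dots> = Cmp C (Cmp C (g d') (bmap C (K d) (K d') (FArr F x) (Idn C Y))) (ii d)"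
        unfolding ii_def
        using comp_bmap_comp[OF F0[OF d] K[OF d] K[OF d'] iF[OF d] iY Fx iY g[OF d']]
        by (simp add: comp_id[OF Fx])
      finally show "Cmp C (w d') (FArr F x) = w d"
        using nat[OF Fx comp_in_hom[OF ii[OF d'] g[OF d']]] compat[OF x] by (simp add: w_def)
    qed
    then obtain w' where w': "w' \<in> hom_set C L (G Z)" "\<And>d. d \<in> Obj J \<Longrightarrow> Cmp C w' (c d) = w d"
      by blast
    then obtain h where h: "h \<in> hom_set C (fst (K0 L)) Z" "\<phi> L Z h = w'"
      using bij[OF LO ZO] by (metis bij_betw_def imageE)
    \<comment> \<open>The arrow \<open>h\<close> starts at the chosen product of \<open>L\<close>
      and \<open>Y\<close>; \<open>j\<close> carries it over to \<open>Q\<close>.\<close>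
    have "Cmp C (Cmp C h j) (m d) = g d" if d: "d \<in> Obj J" for d
    proof -
      have "\<phi> (FObj F d) Z (Cmp C h (k d)) = \<phi> (FObj F d) Z (Cmp C (g d) (ii d))"
        using \<phi>k[OF d h(1)] h(2) w'(2)[OF d] by (simp add: w_def)
      then have hk: "Cmp C h (k d) = Cmp C (g d) (ii d)"
        using bij[OF F.obj_map[OF d] ZO] comp_in_hom[OF k[OF d] h(1)]
          comp_in_hom[OF ii[OF d] g[OF d]]
        by (auto simp: bij_betw_def dest: inj_onD)
      have "Cmp C (Cmp C h j) (m d) = Cmp C (Cmp C h (k d)) (jj d)"
        using comp_assoc[OF m[OF d] j h(1)] comp_assoc[OF jj[OF d] k[OF d] h(1)] jm[OF d] by simp
      also have "\<dots> = Cmp C (g d) (Idn C (fst (K d)))"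
        using comp_assoc[OF jj[OF d] ii[OF d] g[OF d]] hk iijj[OF d] by simp
      finally show ?thesis using comp_id[OF g[OF d]] by simp
    qed
    then show ?thesis
      using comp_in_hom[OF j h(1)] by (auto simp: m_def)
  qed
qed


section \<open>Directed colimits of products\<close>

lemma binprod_exists:
  assumes "cartesian_closed C" and "X \<in> Obj C" and "Y \<in> Obj C"
  shows "\<exists>K. is_binprod C X Y K"
  by (rule cartesian_closed_curry[OF assms(1,3)]) (use assms(2) in blast)

section \<open>Functors and cocones on a poset, in terms of related pairs\<close>

lemma poset_functor:
  assumes "cat_functor (poset_category D r) C F" and r: "partial_order_on D r"
  shows poset_functor_obj: "\<And>d. d \<in> D \<Longrightarrow> FObj F d \<in> Obj C"
    and poset_functor_arr:
      "\<And>d d'. (d, d') \<in> r \<Longrightarrow> FArr F (d, d') \<in> hom_set C (FObj F d) (FObj F d')"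
    and poset_functor_id: "\<And>d. d \<in> D \<Longrightarrow> FArr F (d, d) = Idn C (FObj F d)"
    and poset_functor_comp: "\<And>d d' d''. (d, d') \<in> r \<Longrightarrow> (d', d'') \<in> r \<Longrightarrow>
      Cmp C (FArr F (d', d'')) (FArr F (d, d')) = FArr F (d, d'')"
proof -
  interpret F: cat_functor "poset_category D r" C F by fact
  show "FObj F d \<in> Obj C" if "d \<in> D" for d
    using F.obj_map that by (simp add: poset_category_def)
  show "FArr F (d, d') \<in> hom_set C (FObj F d) (FObj F d')" if "(d, d') \<in> r" for d d'
    by (rule F.arr_map) (use that in \<open>simp add: poset_category_def hom_set_def\<close>)
  show "FArr F (d, d) = Idn C (FObj F d)" if "d \<in> D" for d
    using F.preserves_id[of d] that by (simp add: poset_category_def)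
  show "Cmp C (FArr F (d', d'')) (FArr F (d, d')) = FArr F (d, d'')"
    if "(d, d') \<in> r" and "(d', d'') \<in> r" for d d' d''
    using F.preserves_comp[of "(d, d')" d d' "(d', d'')" d''] that
    by (simp add: poset_category_def hom_set_def)
qed

lemma poset_cocone_iff:
  "is_cocone (poset_category D r) C F L c \<longleftrightarrow> cat_functor (poset_category D r) C F \<and> L \<in> Obj C \<and>
    (\<forall>d\<in>D. c d \<in> hom_set C (FObj F d) L) \<and>
    (\<forall>d d'. (d, d') \<in> r \<longrightarrow> Cmp C (c d') (FArr F (d, d')) = c d)"
  by (auto simp: is_cocone_def poset_category_def)

text \<open>
  A cocone \<open>g\<close> on \<open>d \<mapsto> E d \<times> F d\<close> extends to a family \<open>h d d' : E d \<times> F d' \<rightarrow> Z\<close> by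
  going through \<open>E z \<times> F z\<close> for any upper bound \<open>z\<close> of \<open>d\<close> and \<open>d'\<close>.
\<close>

lemma binprod_colimit:
  fixes D :: "'d set" and r :: "'d rel"
  defines "J \<equiv> poset_category D r"
  assumes ccc: "cartesian_closed C" and dir: "directed_poset D r"
    and E: "is_colimit_cocone J C E L e" and F: "is_colimit_cocone J C F M f"
    and P: "cat_functor J C P"
    and K: "\<And>d. d \<in> D \<Longrightarrow> is_binprod C (FObj E d) (FObj F d) (K d)"
    and fst_K: "\<And>d. d \<in> D \<Longrightarrow> fst (K d) = FObj P d"
    and P_arr: "\<And>d d'. (d, d') \<in> r \<Longrightarrow>
      FArr P (d, d') = bmap C (K d) (K d') (FArr E (d, d')) (FArr F (d, d'))"
    and Q: "is_binprod C L M Q"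
    and m: "\<And>d. d \<in> D \<Longrightarrow> m d = bmap C (K d) Q (e d) (f d)"
  shows "is_colimit_cocone J C P (fst Q) m"
proof -
  have po: "partial_order_on D r" using dir by (simp add: directed_poset_def)
  have rD: "d \<in> D" "d' \<in> D" if "(d, d') \<in> r" for d d'
    using po that by (auto simp: partial_order_on_def preorder_on_def refl_on_def)
  have r_refl: "(d, d) \<in> r" if "d \<in> D" for d
    using po that by (auto simp: partial_order_on_def preorder_on_def refl_on_def)
  have r_trans: "(d, d'') \<in> r" if "(d, d') \<in> r" "(d', d'') \<in> r" for d d' d''
    using po that by (auto simp: partial_order_on_def preorder_on_def dest: transD)
  have bound: "\<exists>z. (d, z) \<in> r \<and> (d', z) \<in> r" if "d \<in> D" "d' \<in> D" for d d'
    using dir that unfolding directed_poset_def by blast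
  have ObjJ: "Obj J = D" by (simp add: J_def poset_category_def)
  have homJ: "x \<in> hom_set J d d' \<longleftrightarrow> x = (d, d') \<and> (d, d') \<in> r" for x d d'
    by (auto simp: J_def poset_category_def hom_set_def)

  have E_cocone: "is_cocone J C E L e" and F_cocone: "is_cocone J C F M f"
    using E F by (simp_all add: is_colimit_cocone_def)
  then have E_fun: "cat_functor J C E" and F_fun: "cat_functor J C F"
    by (simp_all add: is_cocone_def)
  note Eo = poset_functor_obj[OF E_fun[unfolded J_def] po]
    and Ea = poset_functor_arr[OF E_fun[unfolded J_def] po]
    and Eid = poset_functor_id[OF E_fun[unfolded J_def] po]
    and Ec = poset_functor_comp[OF E_fun[unfolded J_def] po]
  note Fo = poset_functor_obj[OF F_fun[unfolded J_def] po]
    and Fa = poset_functor_arr[OF F_fun[unfolded J_def] po]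
    and Fid = poset_functor_id[OF F_fun[unfolded J_def] po]
    and Fc = poset_functor_comp[OF F_fun[unfolded J_def] po]
  have e: "\<And>d. d \<in> D \<Longrightarrow> e d \<in> hom_set C (FObj E d) L"
    and eE: "\<And>d d'. (d, d') \<in> r \<Longrightarrow> Cmp C (e d') (FArr E (d, d')) = e d"
    using E_cocone unfolding J_def poset_cocone_iff by blast+
  have M: "M \<in> Obj C" and f: "\<And>d. d \<in> D \<Longrightarrow> f d \<in> hom_set C (FObj F d) M"
    and fF: "\<And>d d'. (d, d') \<in> r \<Longrightarrow> Cmp C (f d') (FArr F (d, d')) = f d"
    using F_cocone unfolding J_def poset_cocone_iff by blast+
  note iE = id_in_hom[OF Eo] and iF = id_in_hom[OF Fo] and iM = id_in_hom[OF M]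

  \<comment> \<open>The cones \<open>K\<close> cover only the diagonal; those for the mixed products
    have to be chosen.\<close>
  obtain N where "\<forall>X\<in>Obj C. \<forall>Y\<in>Obj C. is_binprod C X Y (N X Y)"
    using binprod_exists[OF ccc] by metis
  note N = this[rule_format]
  define NF NM where "NF d d' = N (FObj E d) (FObj F d')" and "NM d = N (FObj E d) M" for d d'
  have NF: "is_binprod C (FObj E d) (FObj F d') (NF d d')" if "d \<in> D" "d' \<in> D" for d d'
    unfolding NF_def using N Eo Fo that by blast
  have NM: "is_binprod C (FObj E d) M (NM d)" if "d \<in> D" for d
    unfolding NM_def using N Eo M that by blast
  \<comment> \<open>\<open>S\<close> leads from position \<open>(d, d')\<close> to the diagonal at
    an upper bound \<open>z\<close>. \<open>n\<close> and \<open>k\<close> are the legs of the two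
    successive colimits, in the second variable with \<open>d\<close> fixed and then in the
    first.\<close>
  define S where "S d d' z = bmap C (NF d d') (K z) (FArr E (d, z)) (FArr F (d', z))" for d d' z
  define n where "n d d' = bmap C (NF d d') (NM d) (Idn C (FObj E d)) (f d')" for d d'
  define k where "k d = bmap C (NM d) Q (e d) (Idn C M)" for d
  have S: "S d d' z \<in> hom_set C (fst (NF d d')) (fst (K z))"
    if "(d, z) \<in> r" "(d', z) \<in> r" for d d' z
    unfolding S_def using rD[OF that(1)] rD[OF that(2)] by (intro bmap_hom[OF NF K Ea Fa] that)
  have n: "n d d' \<in> hom_set C (fst (NF d d')) (fst (NM d))" if "d \<in> D" "d' \<in> D" for d d'
    unfolding n_def by (intro bmap_hom[OF NF NM iE f] that)
  have k: "k d \<in> hom_set C (fst (NM d)) (fst Q)" if "d \<in> D" for d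
    unfolding k_def by (intro bmap_hom[OF NM Q e iM] that)

  have colimF_ext: "u = v"
    if d: "d \<in> D" and u: "u \<in> hom_set C (fst (NM d)) Z" and v: "v \<in> hom_set C (fst (NM d)) Z"
      and uv: "\<And>d'. d' \<in> D \<Longrightarrow> Cmp C u (n d d') = Cmp C v (n d d')" for d u v Z
  proof (rule times_colimit_ext[OF ccc F, of "FObj E d" "\<lambda>d'. swap_cone (NF d d')" "swap_cone (NM d)"])
    show "is_binprod C (FObj F d') (FObj E d) (swap_cone (NF d d'))" if "d' \<in> Obj J" for d'
      using is_binprod_swap[OF NF[OF d]] that by (simp add: ObjJ)
    show "is_binprod C M (FObj E d) (swap_cone (NM d))"
      by (rule is_binprod_swap[OF NM[OF d]])
    show "Cmp C u (bmap C (swap_cone (NF d d')) (swap_cone (NM d)) (f d') (Idn C (FObj E d))) =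
        Cmp C v (bmap C (swap_cone (NF d d')) (swap_cone (NM d)) (f d') (Idn C (FObj E d)))"
      if "d' \<in> Obj J" for d'
      using uv that by (simp add: ObjJ bmap_swap n_def)
  qed (use u v in simp_all)
  have colimF_factor: "\<exists>u. u \<in> hom_set C (fst (NM d)) Z \<and> (\<forall>d'\<in>D. Cmp C u (n d d') = h d')"
    if d: "d \<in> D" and Z: "Z \<in> Obj C"
      and h: "\<And>d'. d' \<in> D \<Longrightarrow> h d' \<in> hom_set C (fst (NF d d')) Z"
      and compat: "\<And>d' d''. (d', d'') \<in> r \<Longrightarrow>
        Cmp C (h d'') (bmap C (NF d d') (NF d d'') (Idn C (FObj E d)) (FArr F (d', d''))) = h d'"
    for d h Z
  proof -
    have "\<exists>u. u \<in> hom_set C (fst (swap_cone (NM d))) Z \<and>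
      (\<forall>d'\<in>Obj J. Cmp C u (bmap C (swap_cone (NF d d')) (swap_cone (NM d)) (f d') (Idn C (FObj E d)))
        = h d')"
    proof (rule times_colimit_factor[OF ccc F])
      show "is_binprod C (FObj F d') (FObj E d) (swap_cone (NF d d'))" if "d' \<in> Obj J" for d'
        using is_binprod_swap[OF NF[OF d]] that by (simp add: ObjJ)
      show "is_binprod C M (FObj E d) (swap_cone (NM d))"
        by (rule is_binprod_swap[OF NM[OF d]])
      show "h d' \<in> hom_set C (fst (swap_cone (NF d d'))) Z" if "d' \<in> Obj J" for d'
        using h that by (simp add: ObjJ)
      show "Cmp C (h d'') (bmap C (swap_cone (NF d d')) (swap_cone (NF d d'')) (FArr F x)
          (Idn C (FObj E d))) = h d'" if "x \<in> hom_set J d' d''" for d' d'' x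
        using compat that by (simp add: homJ bmap_swap)
    qed (fact Z)
    then show ?thesis by (simp add: ObjJ bmap_swap n_def)
  qed
  note colimE_ext = times_colimit_ext[OF ccc E NM Q, folded k_def, unfolded ObjJ]
    and colimE_factor = times_colimit_factor[OF ccc E NM Q, folded k_def, unfolded ObjJ homJ]

  \<comment> \<open>Together with \<open>mS\<close> this factors e d \<times> f d' in two ways,
    through the iterated colimit and through the diagonal. The comparison of the two colimits rests
    on it.\<close>
  have kn: "Cmp C (k d) (n d d') = bmap C (NF d d') Q (e d) (f d')" if d: "d \<in> D" "d' \<in> D" for d d'
    unfolding k_def n_def
    using bmap_comp[OF NF[OF d] NM[OF d(1)] Q iE[OF d(1)] f[OF d(2)] e[OF d(1)] iM]
      comp_id[OF e[OF d(1)]] id_comp[OF f[OF d(2)]] by simp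
  have mS: "Cmp C (m z) (S d d' z) = bmap C (NF d d') Q (e d) (f d')"
    if z: "(d, z) \<in> r" "(d', z) \<in> r" for d d' z
    unfolding S_def
    using bmap_comp[OF NF K Q Ea[OF z(1)] Fa[OF z(2)] e f] m eE[OF z(1)] fF[OF z(2)]
      rD[OF z(1)] rD[OF z(2)] by simp
  have m_hom: "m d \<in> hom_set C (FObj P d) (fst Q)" if "d \<in> D" for d
    using bmap_hom[OF K[OF that] Q e[OF that] f[OF that]] m[OF that] fst_K[OF that] by simp
  have mP: "Cmp C (m d') (FArr P (d, d')) = m d" if d: "(d, d') \<in> r" for d d'
    using bmap_comp[OF K K Q Ea[OF d] Fa[OF d] e f] eE[OF d] fF[OF d] m P_arr[OF d] rD[OF d] by simp
  have cocone: "is_cocone J C P (fst Q) m"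
    using P is_binprod_Obj(1)[OF Q] m_hom mP unfolding J_def poset_cocone_iff by blast

  have ext: "u = v"
    if u: "u \<in> hom_set C (fst Q) Z" and v: "v \<in> hom_set C (fst Q) Z"
      and uv: "\<And>d. d \<in> D \<Longrightarrow> Cmp C u (m d) = Cmp C v (m d)" for u v Z
  proof (rule colimE_ext[OF _ u v])
    fix d assume d: "d \<in> D"
    show "Cmp C u (k d) = Cmp C v (k d)"
    proof (rule colimF_ext[OF d comp_in_hom[OF k[OF d] u] comp_in_hom[OF k[OF d] v]])
      fix d' assume d': "d' \<in> D"
      \<comment> \<open>The mixed position \<open>(d, d')\<close> maps to the diagonal at
        \<open>z\<close>, where \<open>u\<close> and \<open>v\<close> are known to agree.\<close>
      obtain z where z: "(d, z) \<in> r" "(d', z) \<in> r" using bound[OF d d'] by blast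
      have zD: "z \<in> D" using rD z by blast
      have "Cmp C (Cmp C w (k d)) (n d d') = Cmp C (Cmp C w (m z)) (S d d' z)"
        if w: "w \<in> hom_set C (fst Q) Z" for w
        using comp_assoc[OF n[OF d d'] k[OF d] w] kn[OF d d'] mS[OF z]
          comp_assoc[OF S[OF z, unfolded fst_K[OF zD]] m_hom[OF zD] w] by simp
      from this[OF u] this[OF v]
      show "Cmp C (Cmp C u (k d)) (n d d') = Cmp C (Cmp C v (k d)) (n d d')"
        by (simp add: uv[OF zD])
    qed
  qed

  have factor: "\<exists>u. u \<in> hom_set C (fst Q) Z \<and> (\<forall>d\<in>D. Cmp C u (m d) = g d)"
    if "is_cocone J C P Z g" for Z g
  proof -
    have Z: "Z \<in> Obj C" and g: "\<And>d. d \<in> D \<Longrightarrow> g d \<in> hom_set C (fst (K d)) Z"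
      and gP: "\<And>d d'. (d, d') \<in> r \<Longrightarrow> Cmp C (g d') (FArr P (d, d')) = g d"
      using that fst_K by (simp_all add: J_def poset_cocone_iff)
    \<comment> \<open>An arbitrary choice of upper bound; \<open>h_eq\<close> shows that every other
      one yields the same arrow.\<close>
    define ub where "ub d d' = (SOME z. (d, z) \<in> r \<and> (d', z) \<in> r)" for d d'
    have ub: "(d, ub d d') \<in> r" "(d', ub d d') \<in> r" if "d \<in> D" "d' \<in> D" for d d'
      using someI_ex[OF bound[OF that]] by (auto simp: ub_def)
    define h where "h d d' = Cmp C (g (ub d d')) (S d d' (ub d d'))" for d d'
    have gS: "Cmp C (g z) (S d d' z) = Cmp C (g w) (S d d' w)"
      if z: "(d, z) \<in> r" "(d', z) \<in> r" and w: "(z, w) \<in> r" for d d' z w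
      unfolding S_def
      using comp_bmap_comp[OF NF K K Ea[OF z(1)] Fa[OF z(2)] Ea[OF w] Fa[OF w] g]
        rD[OF z(1)] rD[OF z(2)] rD[OF w]
      by (simp add: gP[OF w] P_arr[OF w, symmetric] Ec[OF z(1) w] Fc[OF z(2) w])
    have h_eq: "h d d' = Cmp C (g z) (S d d' z)" if z: "(d, z) \<in> r" "(d', z) \<in> r" for d d' z
    proof -
      have D: "d \<in> D" "d' \<in> D" "z \<in> D" using rD z by blast+
      have ubD: "ub d d' \<in> D" using rD ub D by blast
      \<comment> \<open>The two upper bounds need not be comparable, so both are pushed to a common
        one.\<close>
      obtain w where w: "(z, w) \<in> r" "(ub d d', w) \<in> r" using bound[OF D(3) ubD] by blast
      show ?thesis
        using gS[OF z w(1)] gS[OF ub[OF D(1,2)] w(2)] by (simp add: h_def)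
    qed
    have h: "h d d' \<in> hom_set C (fst (NF d d')) Z" if "d \<in> D" "d' \<in> D" for d d'
      unfolding h_def using rD(2) ub[OF that] by (intro comp_in_hom[OF S g]) auto
    \<comment> \<open>Both sides are evaluated at one \<open>z\<close> above \<open>d2\<close> and
      \<open>d2'\<close>, which by transitivity also bounds \<open>d\<close> and \<open>d'\<close>.
      Below this is used with an identity in the first variable, and later with one in the
      second.\<close>
    have h_bmap: "Cmp C (h d2 d2') (bmap C (NF d d') (NF d2 d2') (FArr E (d, d2)) (FArr F (d', d2')))
        = h d d'" if d: "(d, d2) \<in> r" "(d', d2') \<in> r" for d d2 d' d2'
    proof -
      have D: "d \<in> D" "d2 \<in> D" "d' \<in> D" "d2' \<in> D" using rD d by blast+
      obtain z where z: "(d2, z) \<in> r" "(d2', z) \<in> r" using bound[OF D(2,4)] by blast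
      then have dz: "(d, z) \<in> r" "(d', z) \<in> r" using r_trans d by blast+
      have zD: "z \<in> D" using rD z by blast
      show ?thesis
        unfolding h_eq[OF z] h_eq[OF dz] S_def
        using comp_bmap_comp[OF NF[OF D(1,3)] NF[OF D(2,4)] K[OF zD] Ea[OF d(1)] Fa[OF d(2)]
            Ea[OF z(1)] Fa[OF z(2)] g[OF zD]]
        by (simp add: Ec[OF d(1) z(1)] Fc[OF d(2) z(2)])
    qed
    have "\<exists>u. u \<in> hom_set C (fst (NM d)) Z \<and> (\<forall>d'\<in>D. Cmp C u (n d d') = h d d')" if d: "d \<in> D" for d
    proof (rule colimF_factor[OF d Z h[OF d]])
      show "Cmp C (h d d'') (bmap C (NF d d') (NF d d'') (Idn C (FObj E d)) (FArr F (d', d''))) = h d d'"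
        if "(d', d'') \<in> r" for d' d''
        using h_bmap[OF r_refl[OF d] that] by (simp add: Eid[OF d])
    qed
    then obtain u where u: "\<And>d. d \<in> D \<Longrightarrow> u d \<in> hom_set C (fst (NM d)) Z"
      and un: "\<And>d d'. d \<in> D \<Longrightarrow> d' \<in> D \<Longrightarrow> Cmp C (u d) (n d d') = h d d'"
      by metis
    have "\<exists>v. v \<in> hom_set C (fst Q) Z \<and> (\<forall>d\<in>D. Cmp C v (k d) = u d)"
    proof (rule colimE_factor[OF _ Z u])
      fix d d2 x assume "x = (d, d2) \<and> (d, d2) \<in> r"
      then have x: "x = (d, d2)" and dr: "(d, d2) \<in> r" by auto
      have D: "d \<in> D" "d2 \<in> D" using rD dr by blast+
      let ?t = "bmap C (NM d) (NM d2) (FArr E (d, d2)) (Idn C M)"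
      have t: "?t \<in> hom_set C (fst (NM d)) (fst (NM d2))"
        by (rule bmap_hom[OF NM[OF D(1)] NM[OF D(2)] Ea[OF dr] iM])
      \<comment> \<open>The arrows \<open>u d\<close> were obtained separately for each
        \<open>d\<close>. Uniqueness of factorizations through the inner colimit forces them to be
        compatible.\<close>
      have "Cmp C (u d2) ?t = u d"
      proof (rule colimF_ext[OF D(1) comp_in_hom[OF t u[OF D(2)]] u[OF D(1)]])
        fix d' assume d': "d' \<in> D"
        let ?s = "bmap C (NF d d') (NF d2 d') (FArr E (d, d2)) (Idn C (FObj F d'))"
        have s: "?s \<in> hom_set C (fst (NF d d')) (fst (NF d2 d'))"
          by (rule bmap_hom[OF NF[OF D(1) d'] NF[OF D(2) d'] Ea[OF dr] iF[OF d']])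
        \<comment> \<open>Interchange: a transition in the first variable commutes with a leg in the
          second.\<close>
        have "Cmp C ?t (n d d') = Cmp C (n d2 d') ?s"
          unfolding n_def
          using bmap_comp[OF NF[OF D(1) d'] NM[OF D(1)] NM[OF D(2)] iE[OF D(1)] f[OF d'] Ea[OF dr] iM]
            bmap_comp[OF NF[OF D(1) d'] NF[OF D(2) d'] NM[OF D(2)] Ea[OF dr] iF[OF d'] iE[OF D(2)] f[OF d']]
            comp_id[OF Ea[OF dr]] id_comp[OF Ea[OF dr]] comp_id[OF f[OF d']] id_comp[OF f[OF d']]
          by simp
        then have "Cmp C (Cmp C (u d2) ?t) (n d d') = Cmp C (h d2 d') ?s"
          using comp_assoc[OF n[OF D(1) d'] t u[OF D(2)]] comp_assoc[OF s n[OF D(2) d'] u[OF D(2)]]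
            un[OF D(2) d'] by simp
        also have "\<dots> = h d d'"
          using h_bmap[OF dr r_refl[OF d']] by (simp add: Fid[OF d'])
        finally show "Cmp C (Cmp C (u d2) ?t) (n d d') = Cmp C (u d) (n d d')"
          using un[OF D(1) d'] by simp
      qed
      then show "Cmp C (u d2) (bmap C (NM d) (NM d2) (FArr E x) (Idn C M)) = u d" by (simp add: x)
    qed
    then obtain v where v: "v \<in> hom_set C (fst Q) Z" and vk: "\<And>d. d \<in> D \<Longrightarrow> Cmp C v (k d) = u d"
      by blast
    have "Cmp C v (m d) = g d" if d: "d \<in> D" for d
    proof -
      \<comment> \<open>\<open>K d\<close> and \<open>NF d d\<close> are cones over the same two
        objects; \<open>?i\<close> passes to the chosen one and \<open>S d d d\<close> leads
        back.\<close>
      let ?i = "bmap C (K d) (NF d d) (Idn C (FObj E d)) (Idn C (FObj F d))"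
      have i: "?i \<in> hom_set C (fst (K d)) (fst (NF d d))"
        by (rule bmap_hom[OF K[OF d] NF[OF d d] iE[OF d] iF[OF d]])
      have Si: "Cmp C (S d d d) ?i = Idn C (fst (K d))"
        unfolding S_def
        using bmap_comp[OF K[OF d] NF[OF d d] K[OF d] iE[OF d] iF[OF d] iE[OF d] iF[OF d]]
          bmap_id[OF K[OF d]] id_comp[OF iE[OF d]] id_comp[OF iF[OF d]]
        by (simp add: Eid[OF d] Fid[OF d])
      have "m d = Cmp C (Cmp C (k d) (n d d)) ?i"
        using bmap_comp[OF K[OF d] NF[OF d d] Q iE[OF d] iF[OF d] e[OF d] f[OF d]]
        by (simp add: kn[OF d d] m[OF d] comp_id[OF e[OF d]] comp_id[OF f[OF d]])
      then have "Cmp C v (m d) = Cmp C (h d d) ?i"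
        using comp_assoc[OF i comp_in_hom[OF n[OF d d] k[OF d]] v] comp_assoc[OF n[OF d d] k[OF d] v]
          vk[OF d] un[OF d d] by simp
      also have "\<dots> = Cmp C (g d) (Cmp C (S d d d) ?i)"
        using comp_assoc[OF i S[OF r_refl[OF d] r_refl[OF d]] g[OF d]]
          h_eq[OF r_refl[OF d] r_refl[OF d]] by simp
      finally show ?thesis using Si comp_id[OF g[OF d]] by simp
    qed
    then show ?thesis using v by blast
  qed

  show ?thesis
    unfolding is_colimit_cocone_def ObjJ
  proof (intro conjI allI impI)
    fix Z g assume "is_cocone J C P Z g"
    from factor[OF this] obtain u where u: "u \<in> hom_set C (fst Q) Z" "\<forall>d\<in>D. Cmp C u (m d) = g d"
      by blast
    then show "\<exists>!u. u \<in> hom_set C (fst Q) Z \<and> (\<forall>d\<in>D. Cmp C u (m d) = g d)"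
      using ext by (intro ex1I[of _ u]) auto
  qed (fact cocone)
qed

section \<open>Induction on the number of factors\<close>

text \<open>Both sides have the same two projections; the one to \<open>R'\<close> is tested on the
  components \<open>s' j\<close>. The induction step needs this twice, for the transition arrows of
  the diagram and for the legs of the cocone.\<close>

lemma prod_arr_insert:
  assumes P: "is_product C (insert k I) A P p" and P': "is_product C (insert k I) B P' p'"
    and R: "is_product C I A R s" and R': "is_product C I B R' s'" and k: "k \<notin> I"
    and a: "a \<in> hom_set C P R" "\<And>j. j \<in> I \<Longrightarrow> Cmp C (s j) a = p j"
    and a': "a' \<in> hom_set C P' R'" "\<And>j. j \<in> I \<Longrightarrow> Cmp C (s' j) a' = p' j"
    and f: "\<And>j. j \<in> insert k I \<Longrightarrow> f j \<in> hom_set C (A j) (B j)"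
  shows "prod_arr C (insert k I) P p P' p' f =
    bmap C (P, a, p k) (P', a', p' k) (prod_arr C I R s R' s' f) (f k)" (is "?m = bmap C _ _ ?n _")
proof -
  note m = prod_arr[where f = f, OF P P' f] and n = prod_arr[where f = f, OF R R' f[OF insertI2]]
  have s: "s j \<in> hom_set C R (A j)" and s': "s' j \<in> hom_set C R' (B j)" if "j \<in> I" for j
    using R R' that by (simp_all add: is_product_def)
  have mP: "?m \<in> hom_set C P P'" and nR: "?n \<in> hom_set C R R'" using m(1) n(1) by simp_all
  have "Cmp C a' ?m = Cmp C ?n a"
  proof (rule is_product_ext[OF R' comp_in_hom[OF mP a'(1)] comp_in_hom[OF a(1) nR]])
    fix j assume j: "j \<in> I"
    have "Cmp C (s' j) (Cmp C a' ?m) = Cmp C (f j) (p j)"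
      using comp_assoc[OF mP a'(1) s'[OF j]] a'(2)[OF j] m(2)[of j] j by simp
    also have "\<dots> = Cmp C (s' j) (Cmp C ?n a)"
      using comp_assoc[OF a(1) nR s'[OF j]] comp_assoc[OF a(1) s[OF j] f[of j]] a(2)[OF j] n(2)[of j] j
      by simp
    finally show "Cmp C (s' j) (Cmp C a' ?m) = Cmp C (s' j) (Cmp C ?n a)" .
  qed
  moreover have "Cmp C (p' k) ?m = Cmp C (f k) (p k)" using m(2)[of k] by simp
  ultimately show ?thesis
    using bmap_eq[OF is_binprod_insert[OF P R k a] is_binprod_insert[OF P' R' k a'] nR f[of k] mP]
    by simp
qed

text \<open>The vertices \<open>P d\<close> and \<open>Q\<close> are terminal, so diagrams ending in
  them commute. A member of the poset gives the factorization, and upper bounds make it agree with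
  every leg.\<close>

lemma empty_prod_colimit:
  assumes dir: "directed_poset D r"
    and P: "\<And>d. d \<in> D \<Longrightarrow> is_product C {} (\<lambda>j. FObj (F j) d) (P d) (p d)"
    and Q: "is_product C {} L Q q"
  shows "is_colimit_cocone (poset_category D r) C (prod_functor (poset_category D r) C {} F P p)
    Q (\<lambda>d. prod_arr C {} (P d) (p d) Q q (\<lambda>j. c j d))"
    (is "is_colimit_cocone ?J C ?F Q ?m")
  unfolding is_colimit_cocone_def
proof (intro conjI allI impI)
  have po: "partial_order_on D r" using dir by (simp add: directed_poset_def)
  have J: "category ?J" by (rule category_poset_category[OF po])
  have ObjJ: "Obj ?J = D" by (simp add: poset_category_def)
  have ob: "FObj ?F = P" by (simp add: prod_functor_def)
  show cocone: "is_cocone ?J C ?F Q ?m"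
    by (rule is_cocone_prod[OF _ _ Q J]) (use P in \<open>simp_all add: ObjJ\<close>)
  have QO: "Q \<in> Obj C" using Q by (simp add: is_product_def)
  have toP: "x = y" if "d \<in> D" "x \<in> hom_set C X (P d)" "y \<in> hom_set C X (P d)" for d x y X
    using is_product_ext[OF P[OF that(1)] that(2,3)] by simp
  have toQ: "x = y" if "x \<in> hom_set C X Q" "y \<in> hom_set C X Q" for x y X
    using is_product_ext[OF Q that] by simp
  have m: "?m d \<in> hom_set C (P d) Q" if "d \<in> D" for d
    using cocone that by (simp add: poset_cocone_iff ob)
  fix Z g assume "is_cocone ?J C ?F Z g"
  then have F: "cat_functor ?J C ?F"
    and g: "\<And>d. d \<in> D \<Longrightarrow> g d \<in> hom_set C (P d) Z"
    and gF: "\<And>d d'. (d, d') \<in> r \<Longrightarrow> Cmp C (g d') (FArr ?F (d, d')) = g d"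
    by (simp_all add: poset_cocone_iff ob)
  note Fa = poset_functor_arr[OF F po, unfolded ob]
  obtain d0 where d0: "d0 \<in> D" using dir by (auto simp: directed_poset_def)
  have "\<exists>!t. t \<in> hom_set C Q (P d0)" using P[OF d0] QO by (simp add: is_product_def)
  then obtain t where t: "t \<in> hom_set C Q (P d0)" by (elim ex1E)
  let ?u = "Cmp C (g d0) t"
  have "Cmp C ?u (?m d) = g d" if d: "d \<in> D" for d
  proof -
    \<comment> \<open>The legs \<open>g d\<close> and \<open>g d0\<close> both factor through
      \<open>g z\<close>, and the two routes from \<open>P d\<close> to the terminal object
      \<open>P z\<close> coincide.\<close>
    obtain z where zD: "z \<in> D" and z: "(d, z) \<in> r" "(d0, z) \<in> r"
      using dir d d0 unfolding directed_poset_def by blast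
    note tm = comp_in_hom[OF m[OF d] t]
    have eq: "Cmp C (FArr ?F (d0, z)) (Cmp C t (?m d)) = FArr ?F (d, z)"
      by (rule toP[OF zD comp_in_hom[OF tm Fa[OF z(2)]] Fa[OF z(1)]])
    have "Cmp C ?u (?m d) = Cmp C (Cmp C (g z) (FArr ?F (d0, z))) (Cmp C t (?m d))"
      using comp_assoc[OF m[OF d] t g[OF d0]] gF[OF z(2)] by simp
    also have "\<dots> = g d"
      using comp_assoc[OF tm Fa[OF z(2)] g[OF zD]] eq gF[OF z(1)] by simp
    finally show ?thesis .
  qed
  note um = this
  \<comment> \<open>As \<open>Q\<close> is terminal, \<open>t\<close> is a section of
    \<open>?m d0\<close>, so \<open>v\<close> can be recovered from its composite with that one
    leg.\<close>
  have uniq: "v = ?u" if v: "v \<in> hom_set C Q Z" and vm: "Cmp C v (?m d0) = g d0" for v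
  proof -
    have "Cmp C (?m d0) t = Idn C Q"
      by (rule toQ[OF comp_in_hom[OF t m[OF d0]] id_in_hom[OF QO]])
    then show ?thesis using comp_assoc[OF t m[OF d0] v] vm comp_id[OF v] by simp
  qed
  show "\<exists>!u. u \<in> hom_set C Q Z \<and> (\<forall>d\<in>Obj ?J. Cmp C u (?m d) = g d)"
  proof (rule ex1I[of _ ?u])
    show "?u \<in> hom_set C Q Z \<and> (\<forall>d\<in>Obj ?J. Cmp C ?u (?m d) = g d)"
      using comp_in_hom[OF t g[OF d0]] um by (simp add: ObjJ)
    show "v = ?u" if "v \<in> hom_set C Q Z \<and> (\<forall>d\<in>Obj ?J. Cmp C v (?m d) = g d)" for v
      by (rule uniq) (use that d0 in \<open>simp_all add: ObjJ\<close>)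
  qed
qed

text \<open>The given products of \<open>Suc n\<close> factors come with no products of the first
  \<open>n\<close> factors. The latter are chosen inside the step, which is why the cones must vary
  in the induction.\<close>

lemma prod_colimit:
  fixes n :: nat
  assumes ccc: "cartesian_closed C" and dir: "directed_poset D r"
    and "\<And>j. j \<in> {1..n} \<Longrightarrow> is_colimit_cocone (poset_category D r) C (F j) (L j) (c j)"
    and "\<And>d. d \<in> D \<Longrightarrow> is_product C {1..n} (\<lambda>j. FObj (F j) d) (P d) (p d)"
    and "is_product C {1..n} L Q q"
  shows "is_colimit_cocone (poset_category D r) C
    (prod_functor (poset_category D r) C {1..n} F P p)
    Q (\<lambda>d. prod_arr C {1..n} (P d) (p d) Q q (\<lambda>j. c j d))"
  using assms(3-)
proof (induction n arbitrary: P p Q q)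
  case 0
  then show ?case using empty_prod_colimit[OF dir, of F P p L Q q c] by simp
next
  case (Suc n)
  let ?J = "poset_category D r" and ?I = "{1..n}" and ?k = "Suc n"
  let ?P = "prod_functor ?J C {1..?k} F P p"
  let ?m = "\<lambda>d. prod_arr C {1..?k} (P d) (p d) Q q (\<lambda>j. c j d)"
  have I: "{1..?k} = insert ?k ?I" by auto
  have kI: "?k \<notin> ?I" by simp
  have po: "partial_order_on D r" using dir by (simp add: directed_poset_def)
  have J: "category ?J" by (rule category_poset_category[OF po])
  have ObjJ: "Obj ?J = D" by (simp add: poset_category_def)
  have rD: "d \<in> D" "d' \<in> D" if "(d, d') \<in> r" for d d'
    using po that by (auto simp: partial_order_on_def preorder_on_def refl_on_def)
  note P = Suc.prems(2)[unfolded I] and Q = Suc.prems(3)[unfolded I]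
  have colim: "is_colimit_cocone ?J C (F j) (L j) (c j)" if "j \<in> insert ?k ?I" for j
    using Suc.prems(1) that unfolding I .
  have cocone: "is_cocone ?J C (F j) (L j) (c j)" if "j \<in> insert ?k ?I" for j
    using colim[OF that] by (simp add: is_colimit_cocone_def)
  have F: "cat_functor ?J C (F j)" and L: "L j \<in> Obj C"
    and c: "\<And>d. d \<in> D \<Longrightarrow> c j d \<in> hom_set C (FObj (F j) d) (L j)" if "j \<in> insert ?k ?I" for j
    using cocone[OF that] by (simp_all add: poset_cocone_iff)
  have prods: "\<exists>P p. is_product C {1..i} A P p" if "\<forall>j\<in>{1..i}. A j \<in> Obj C" for i :: nat and A
    using ccc that by (simp add: cartesian_closed_def has_finite_products_def)
  have "\<exists>R s. is_product C ?I (\<lambda>j. FObj (F j) d) R s" if d: "d \<in> D" for d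
  proof -
    have "\<forall>j\<in>?I. FObj (F j) d \<in> Obj C" using poset_functor_obj[OF F po d] by blast
    then show ?thesis by (rule prods)
  qed
  then obtain R s where R: "\<And>d. d \<in> D \<Longrightarrow> is_product C ?I (\<lambda>j. FObj (F j) d) (R d) (s d)"
    by metis
  have "\<forall>j\<in>?I. L j \<in> Obj C" using L by blast
  then obtain V v where V: "is_product C ?I L V v"
    using prods by blast
  \<comment> \<open>Supplies the arrows \<open>a d\<close> and \<open>b\<close> that drop the last
    factor and so present the given products as binary ones.\<close>
  have proj: "\<exists>a. a \<in> hom_set C X Y \<and> (\<forall>j\<in>?I. Cmp C (y j) a = x j)"
    if X: "is_product C (insert ?k ?I) A X x" and Y: "is_product C ?I A Y y" for A X x Y y
  proof -
    have "X \<in> Obj C" and "\<forall>j\<in>?I. x j \<in> hom_set C X (A j)" using X by (simp_all add: is_product_def)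
    from is_product_ex1[OF Y this] show ?thesis by blast
  qed
  obtain a where a: "\<And>d. d \<in> D \<Longrightarrow> a d \<in> hom_set C (P d) (R d)"
    and sa: "\<And>d j. d \<in> D \<Longrightarrow> j \<in> ?I \<Longrightarrow> Cmp C (s d j) (a d) = p d j"
    using proj[OF P R] by metis
  obtain b where b: "b \<in> hom_set C Q V" and vb: "\<And>j. j \<in> ?I \<Longrightarrow> Cmp C (v j) b = q j"
    using proj[OF Q V] by metis
  let ?R = "prod_functor ?J C ?I F R s"
  let ?e = "\<lambda>d. prod_arr C ?I (R d) (s d) V v (\<lambda>j. c j d)"
  \<comment> \<open>\<open>Q\<close> is written as the vertex of a binary cone, the shape in which
    \<open>binprod_colimit\<close> concludes.\<close>
  have "is_colimit_cocone ?J C ?P (fst (Q, b, q ?k)) ?m"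
  proof (rule binprod_colimit[OF ccc dir])
    show "is_colimit_cocone ?J C ?R V ?e"
      by (rule Suc.IH[OF _ R V]) (use colim in simp_all)
    show "is_colimit_cocone ?J C (F ?k) (L ?k) (c ?k)" by (rule colim) simp
    show "cat_functor ?J C ?P"
      unfolding I by (rule cat_functor_prod_functor[OF F P J]) (simp_all add: ObjJ)
    show "is_binprod C (FObj ?R d) (FObj (F ?k) d) (P d, a d, p d ?k)" if d: "d \<in> D" for d
      using is_binprod_insert[OF P[OF d] R[OF d] kI a[OF d] sa[OF d]]
      by (simp add: prod_functor_def)
    show "fst (P d, a d, p d ?k) = FObj ?P d" for d by (simp add: prod_functor_def)
    show "is_binprod C V (L ?k) (Q, b, q ?k)" by (rule is_binprod_insert[OF Q V kI b vb])
    show "FArr ?P (d, d') = bmap C (P d, a d, p d ?k) (P d', a d', p d' ?k)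
        (FArr ?R (d, d')) (FArr (F ?k) (d, d'))" if d: "(d, d') \<in> r" for d d'
    proof -
      have D: "d \<in> D" "d' \<in> D" using rD d by blast+
      show ?thesis
        unfolding I
        using prod_arr_insert[where f = "\<lambda>j. FArr (F j) (d, d')", OF P[OF D(1)] P[OF D(2)]
            R[OF D(1)] R[OF D(2)] kI a[OF D(1)] sa[OF D(1)] a[OF D(2)] sa[OF D(2)]
            poset_functor_arr[OF F po d]]
        by (simp add: prod_functor_def poset_category_def)
    qed
    show "?m d = bmap C (P d, a d, p d ?k) (Q, b, q ?k) (?e d) (c ?k d)" if d: "d \<in> D" for d
      unfolding I
      using prod_arr_insert[where f = "\<lambda>j. c j d", OF P[OF d] Q R[OF d] V kI a[OF d] sa[OF d] b vb
          c[OF _ d]]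
      by simp
  qed
  then show ?case by simp
qed

end

theorem theorem2p12:
  fixes C :: "('o, 'm) category"
    and D :: "'d set" and r :: "'d rel"
    and n :: nat
    and F :: "nat \<Rightarrow> ('d, 'd \<times> 'd, 'o, 'm) cat_functor"
    and L :: "nat \<Rightarrow> 'o" and c :: "nat \<Rightarrow> 'd \<Rightarrow> 'm"
    and P :: "'d \<Rightarrow> 'o" and p :: "'d \<Rightarrow> nat \<Rightarrow> 'm"
    and Q :: 'o and q :: "nat \<Rightarrow> 'm"
  assumes "category C"
    and "cartesian_closed C"
    and "directed_poset D r"
    and "\<And>j. j \<in> {1..n} \<Longrightarrow> cat_functor (poset_category D r) C (F j)"
    and "\<And>j. j \<in> {1..n} \<Longrightarrow> is_colimit_cocone (poset_category D r) C (F j) (L j) (c j)"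
    and "\<And>d. d \<in> D \<Longrightarrow> is_product C {1..n} (\<lambda>j. FObj (F j) d) (P d) (p d)"
    and "is_product C {1..n} L Q q"
  shows "is_colimit_cocone (poset_category D r) C
    (prod_functor (poset_category D r) C {1..n} F P p)
    Q (\<lambda>d. prod_arr C {1..n} (P d) (p d) Q q (\<lambda>j. c j d))"
  by (rule category.prod_colimit[OF assms(1-3,5-7)])

end
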